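(* There is an absolute constant $c>0$ such that the following holds. Let $k\geq 2$ and $n$ be integers with $k\mid n$, let $s>0$ be an integer, let $0<\varepsilon<1/2$, and let $\mathcal{G}$ be any class of Boolean functions on $n$ bits. If $C\in{\sf FORMULA}[s]\circ\mathcal{G}$ satisfies \[ \Pr_{x\sim\{0,1\}^n}\big[C(x)={\sf GIP}^k_n(x)\big]\geq \tfrac12+\varepsilon , \] then \[ s\;\geq\; c\cdot \frac{n^2}{k^2\cdot 16^k\cdot\big(R^{(k)}_{\varepsilon/(2n^2)}(\mathcal{G})+\log n\big)^2\cdot\log^2(1/\varepsilon)}. \]
   Context: A de Morgan formula is a rooted tree whose internal gates are AND, OR (fan-in 2) and NOT (fan-in 1) and whose leaves are labelled by inputs; its size is the number of leaves. For a class $\mathcal{G}$ of Boolean functions on $n$ bits, ${\sf FORMULA}[s]\circ\mathcal{G}$ is the class of functions $F(g_1(x),\dots,g_s(x))$ where $F$ is a de Morgan formula of size at most $s$ and each $g_i\in\mathcal{G}$ (applied to the whole input $x$). Generalized inner product: for $x=(x^{(1)},\dots,x^{(k)})$ with $x^{(i)}\in\{0,1\}^{n/k}$, ${\sf GIP}^k_n(x)=\sum_{j=1}^{n/k}\prod_{i=1}^k x^{(i)}_j \bmod 2$. Number-on-forehead (NOF) model: the $n$-bit input is split canonically into $k$ consecutive blocks $x^{(1)},\dots,x^{(k)}$ of $n/k$ bits; player $i$ sees all blocks except $x^{(i)}$; players communicate by writing bits on a shared blackboard. $R^{(k)}_\delta(g)$ is the minimum cost (number of bits communicated in the worst case) of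 a public-coin randomized $k$-party NOF protocol that outputs $g(x)$ with probability at least $1-\delta$ on every input $x$; $R^{(k)}_\delta(\mathcal{G})=\max_{g\in\mathcal{G}}R^{(k)}_\delta(g)$. *)

theory Defs
  imports "HOL-Probability.Probability_Mass_Function"
begin

definition bitvecs :: "nat \<Rightarrow> bool list set" where
  "bitvecs n = {x. length x = n}"

text \<open>Block i (0-based, i < k) of x consists of positions i*(n div k) + j, j < n div k.
  GIP is the parity of the number of columns j in which all k blocks have a 1.\<close>
definition gip :: "nat \<Rightarrow> nat \<Rightarrow> bool list \<Rightarrow> bool" where
  "gip k n x = odd (card {j. j < n div k \<and> (\<forall>i<k. x ! (i * (n div k) + j))})"

datatype dmformula = Var nat | Neg dmformula | Conj dmformula dmformula | Disj dmformula dmformula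

fun fsize :: "dmformula \<Rightarrow> nat" where
  "fsize (Var v) = 1"
| "fsize (Neg f) = fsize f"
| "fsize (Conj f g) = fsize f + fsize g"
| "fsize (Disj f g) = fsize f + fsize g"

fun fvars :: "dmformula \<Rightarrow> nat set" where
  "fvars (Var v) = {v}"
| "fvars (Neg f) = fvars f"
| "fvars (Conj f g) = fvars f \<union> fvars g"
| "fvars (Disj f g) = fvars f \<union> fvars g"

fun feval :: "dmformula \<Rightarrow> (nat \<Rightarrow> bool) \<Rightarrow> bool" where
  "feval (Var v) a = a v"
| "feval (Neg f) a = (\<not> feval f a)"
| "feval (Conj f g) a = (feval f a \<and> feval g a)"
| "feval (Disj f g) a = (feval f a \<or> feval g a)"

definition formula_comp_class ::
  "nat \<Rightarrow> nat \<Rightarrow> (bool list \<Rightarrow> bool) set \<Rightarrow> (bool list \<Rightarrow> bool) \<Rightarrow> bool" where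
  "formula_comp_class n s G C \<longleftrightarrow>
     (\<exists>F g. fsize F \<le> s \<and> fvars F \<subseteq> {..<s} \<and> (\<forall>i<s. g i \<in> G) \<and>
            (\<forall>x\<in>bitvecs n. C x = feval F (\<lambda>i. g i x)))"

text \<open>Deterministic protocol trees. At a node Send i f p0 p1, player i (0-based) writes
  the bit f x on the blackboard (the history is encoded by the position in the tree),
  and the protocol continues with p0 or p1. Leaves give the output.\<close>
datatype nof = Out bool | Send nat "bool list \<Rightarrow> bool" nof nof

fun nof_run :: "nof \<Rightarrow> bool list \<Rightarrow> bool" where
  "nof_run (Out b) x = b"
| "nof_run (Send i f p0 p1) x = (if f x then nof_run p1 x else nof_run p0 x)"

fun nof_cost :: "nof \<Rightarrow> nat" where
  "nof_cost (Out b) = 0"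
| "nof_cost (Send i f p0 p1) = Suc (max (nof_cost p0) (nof_cost p1))"

text \<open>Validity: the speaker i is one of the k players and its bit does not depend on
  block i (its own forehead), i.e. positions j with j div (n div k) = i.\<close>
fun nof_valid :: "nat \<Rightarrow> nat \<Rightarrow> nof \<Rightarrow> bool" where
  "nof_valid k n (Out b) = True"
| "nof_valid k n (Send i f p0 p1) =
     (i < k \<and>
      (\<forall>x\<in>bitvecs n. \<forall>y\<in>bitvecs n.
          (\<forall>j<n. j div (n div k) \<noteq> i \<longrightarrow> x ! j = y ! j) \<longrightarrow> f x = f y) \<and>
      nof_valid k n p0 \<and> nof_valid k n p1)"

text \<open>Public-coin randomized protocol of cost at most c computing g with error at most
  delta: a probability distribution over valid deterministic protocols of cost \<le> c.\<close>
definition rand_nof_computes ::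
  "nat \<Rightarrow> nat \<Rightarrow> real \<Rightarrow> (bool list \<Rightarrow> bool) \<Rightarrow> nat \<Rightarrow> bool" where
  "rand_nof_computes k n \<delta> g c \<longleftrightarrow>
     (\<exists>P :: nof pmf.
        (\<forall>p\<in>set_pmf P. nof_valid k n p \<and> nof_cost p \<le> c) \<and>
        (\<forall>x\<in>bitvecs n. measure_pmf.prob P {p. nof_run p x = g x} \<ge> 1 - \<delta>))"

definition R_nof :: "nat \<Rightarrow> nat \<Rightarrow> real \<Rightarrow> (bool list \<Rightarrow> bool) \<Rightarrow> nat" where
  "R_nof k n \<delta> g = (LEAST c. rand_nof_computes k n \<delta> g c)"

definition R_nof_class :: "nat \<Rightarrow> nat \<Rightarrow> real \<Rightarrow> (bool list \<Rightarrow> bool) set \<Rightarrow> nat" where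
  "R_nof_class k n \<delta> G = Sup ((\<lambda>g. R_nof k n \<delta> g) ` G)"

end

theory Submission
  imports Defs
begin

text \<open>A formula with \<open>r\<close> leaves has a span program of complexity \<open>sqrt r\<close>: weighting the two
  sub-programs of an AND gate by their negative sizes makes the squared complexities add. The
  program yields an isometry \<open>U\<close>, linear in the signs of the inputs, whose start vector is almost
  fixed when the formula accepts and is \<open>(\<psi> - U \<psi>) / 2\<close> for a vector \<open>\<psi>\<close> of norm \<open>O(sqrt r)\<close> when it
  rejects. The diagonal entry of the average of \<open>O(sqrt r)\<close> powers of \<open>U\<close> is therefore a polynomial
  of that degree approximating the formula to constant error, and a binomial tail of degree
  \<open>O(log (1/\<epsilon>))\<close> brings the error down to \<open>\<epsilon>\<close>.

  Fixing the coins of the protocols, the approximation becomes a combination of products of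
  few protocols, each a sum of few cylinder functions. By the
  Babai--Nisan--Szegedy argument a cylinder function has correlation at most
  \<open>(1 - 4 / 4^k)^(n/k)\<close> with the generalized inner product, and comparing this with the advantage
  \<open>\<epsilon>\<close> bounds the degree, hence the number of leaves, from below.\<close>

subsection \<open>Span programs of formulas\<close>

definition sg :: "bool \<Rightarrow> real" where
  "sg b = (if b then -1 else 1)"

lemma abs_sg [simp]: "\<bar>sg b\<bar> = 1"
  by (simp add: sg_def)

lemma sum_lessThan_add:
  fixes h :: "nat \<Rightarrow> real"
  shows "(\<Sum>l<m+n. h l) = (\<Sum>l<m. h l) + (\<Sum>l<n. h (m + l))"
  by (induction n) (simp_all add: add.assoc)

text \<open>The one-dimensional-per-leaf form of a solution to the dual adversary program of \<open>f\<close>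
  (equivalently, of a span program): \<open>u\<close> serves the inputs accepted by \<open>f\<close>, \<open>v\<close> the rejected ones,
  and leaf \<open>l\<close> queries variable \<open>w l\<close>. The complexity is the geometric mean of \<open>P\<close> and \<open>N\<close>.\<close>

definition span_witness ::
  "((nat \<Rightarrow> bool) \<Rightarrow> bool) \<Rightarrow> nat set \<Rightarrow> nat \<Rightarrow> real \<Rightarrow> real \<Rightarrow> bool" where
  "span_witness f V r P N \<longleftrightarrow> (\<exists>w u v.
     (\<forall>l<r. w l \<in> V) \<and>
     (\<forall>a. f a \<longrightarrow> (\<Sum>l<r. (u a l)\<^sup>2) \<le> P) \<and>
     (\<forall>b. \<not> f b \<longrightarrow> (\<Sum>l<r. (v b l)\<^sup>2) \<le> N) \<and>
     (\<forall>a b. f a \<longrightarrow> \<not> f b \<longrightarrow>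
        (\<Sum>l<r. if a (w l) \<noteq> b (w l) then u a l * v b l else 0) = (1::real)))"

lemma span_witness_Var: "span_witness (\<lambda>a. a i) {i} 1 1 1"
  unfolding span_witness_def
  by (rule exI[of _ "\<lambda>_. i"], rule exI[of _ "\<lambda>_ _. 1"], rule exI[of _ "\<lambda>_ _. 1"]) auto

text \<open>The condition that a leaf distinguishes \<open>a\<close> from \<open>b\<close> is
  symmetric, so exchanging \<open>u\<close> and \<open>v\<close> exchanges \<open>P\<close> and
  \<open>N\<close>.\<close>

lemma span_witness_Neg:
  assumes "span_witness f V r P N"
  shows "span_witness (\<lambda>a. \<not> f a) V r N P"
proof -
  obtain w u v where *: "\<forall>l<r. w l \<in> V" "\<forall>a. f a \<longrightarrow> (\<Sum>l<r. (u a l)\<^sup>2) \<le> P"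
     "\<forall>b. \<not> f b \<longrightarrow> (\<Sum>l<r. (v b l)\<^sup>2) \<le> N"
     "\<forall>a b. f a \<longrightarrow> \<not> f b \<longrightarrow>
        (\<Sum>l<r. if a (w l) \<noteq> b (w l) then u a l * v b l else 0) = (1::real)"
    using assms unfolding span_witness_def by blast
  have "(\<Sum>l<r. if a (w l) \<noteq> b (w l) then v a l * u b l else 0) = (1::real)"
    if "\<not> f a" "f b" for a b
  proof -
    have "(\<Sum>l<r. if a (w l) \<noteq> b (w l) then v a l * u b l else 0) =
      (\<Sum>l<r. if b (w l) \<noteq> a (w l) then u b l * v a l else 0)"
      by (intro sum.cong) auto
    with *(4) that show ?thesis by simp
  qed
  with * show ?thesis
    unfolding span_witness_def by (intro exI[of _ w] exI[of _ v] exI[of _ u]) auto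
qed

text \<open>Concatenate the programs, scaling positive witnesses by \<open>sqrt N1\<close> and
  \<open>sqrt N2\<close> and negative ones by the inverses, so that pairings are unchanged. A
  rejected input is served by a single rejecting conjunct, which keeps the negative bound at 1,
  while the positive bounds add up to the sum of the two products \<open>N * P\<close>.\<close>

lemma span_witness_Conj:
  assumes 1: "span_witness f V1 r1 P1 N1" and 2: "span_witness g V2 r2 P2 N2"
    and N: "N1 > 0" "N2 > 0"
  shows "span_witness (\<lambda>a. f a \<and> g a) (V1 \<union> V2) (r1 + r2) (N1 * P1 + N2 * P2) 1"
proof -
  obtain w1 u1 v1 where *: "\<forall>l<r1. w1 l \<in> V1" "\<forall>a. f a \<longrightarrow> (\<Sum>l<r1. (u1 a l)\<^sup>2) \<le> P1"
     "\<forall>b. \<not> f b \<longrightarrow> (\<Sum>l<r1. (v1 b l)\<^sup>2) \<le> N1"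
     "\<forall>a b. f a \<longrightarrow> \<not> f b \<longrightarrow>
        (\<Sum>l<r1. if a (w1 l) \<noteq> b (w1 l) then u1 a l * v1 b l else 0) = (1::real)"
    using 1 unfolding span_witness_def by blast
  obtain w2 u2 v2 where **: "\<forall>l<r2. w2 l \<in> V2" "\<forall>a. g a \<longrightarrow> (\<Sum>l<r2. (u2 a l)\<^sup>2) \<le> P2"
     "\<forall>b. \<not> g b \<longrightarrow> (\<Sum>l<r2. (v2 b l)\<^sup>2) \<le> N2"
     "\<forall>a b. g a \<longrightarrow> \<not> g b \<longrightarrow>
        (\<Sum>l<r2. if a (w2 l) \<noteq> b (w2 l) then u2 a l * v2 b l else 0) = (1::real)"
    using 2 unfolding span_witness_def by blast
  define w where "w l = (if l < r1 then w1 l else w2 (l - r1))" for l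
  define u where "u a l = (if l < r1 then sqrt N1 * u1 a l else sqrt N2 * u2 a (l - r1))" for a l
  define v where "v b l = (if \<not> f b then if l < r1 then v1 b l / sqrt N1 else 0
      else if l < r1 then 0 else v2 b (l - r1) / sqrt N2)" for b l
  have W: "w l \<in> V1 \<union> V2" if "l < r1 + r2" for l
    using that * ** unfolding w_def by auto
  have U: "(\<Sum>l<r1+r2. (u a l)\<^sup>2) \<le> N1 * P1 + N2 * P2" if "f a \<and> g a" for a
  proof -
    have "(\<Sum>l<r1+r2. (u a l)\<^sup>2) = N1 * (\<Sum>l<r1. (u1 a l)\<^sup>2) + N2 * (\<Sum>l<r2. (u2 a l)\<^sup>2)"
      using N by (simp add: sum_lessThan_add u_def power_mult_distrib sum_distrib_left)
    also have "\<dots> \<le> N1 * P1 + N2 * P2"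
      using that * ** N by (intro add_mono mult_left_mono) auto
    finally show ?thesis .
  qed
  have V: "(\<Sum>l<r1+r2. (v b l)\<^sup>2) \<le> 1" if "\<not> (f b \<and> g b)" for b
  proof (cases "f b")
    case True
    have "(\<Sum>l<r1+r2. (v b l)\<^sup>2) = (\<Sum>l<r2. (v2 b l)\<^sup>2) / N2"
      using N True by (simp add: sum_lessThan_add v_def power_divide sum_divide_distrib)
    also have "\<dots> \<le> 1" using True that ** N by auto
    finally show ?thesis .
  next
    case False
    have "(\<Sum>l<r1+r2. (v b l)\<^sup>2) = (\<Sum>l<r1. (v1 b l)\<^sup>2) / N1"
      using N False by (simp add: sum_lessThan_add v_def power_divide sum_divide_distrib)
    also have "\<dots> \<le> 1" using False that * N by auto
    finally show ?thesis .
  qed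
  have UV: "(\<Sum>l<r1+r2. if a (w l) \<noteq> b (w l) then u a l * v b l else 0) = 1"
    if a: "f a \<and> g a" and b: "\<not> (f b \<and> g b)" for a b
  proof (cases "f b")
    case True
    have "(\<Sum>l<r1+r2. if a (w l) \<noteq> b (w l) then u a l * v b l else 0) =
       (\<Sum>l<r2. if a (w2 l) \<noteq> b (w2 l) then u2 a l * v2 b l else 0)"
      using N True by (simp add: sum_lessThan_add v_def u_def w_def if_distrib cong: if_cong)
    then show ?thesis using **(4) a b True by simp
  next
    case False
    have "(\<Sum>l<r1+r2. if a (w l) \<noteq> b (w l) then u a l * v b l else 0) =
       (\<Sum>l<r1. if a (w1 l) \<noteq> b (w1 l) then u1 a l * v1 b l else 0)"
      using N False by (simp add: sum_lessThan_add v_def u_def w_def if_distrib cong: if_cong)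
    then show ?thesis using *(4) a b False by simp
  qed
  show ?thesis
    unfolding span_witness_def
    by (rule exI[of _ w], rule exI[of _ u], rule exI[of _ v])
      (intro conjI allI impI; rule W U V UV; assumption)
qed

text \<open>The bound on \<open>P * N\<close> adds at a conjunction and is invariant under negation;
  disjunction is reduced to conjunction by de Morgan's law.\<close>

lemma span_witness_formula:
  "\<exists>P N :: real. P > 0 \<and> N > 0 \<and> P * N \<le> fsize F \<and> span_witness (feval F) (fvars F) (fsize F) P N"
proof (induction F)
  case (Var i)
  then show ?case using span_witness_Var[of i] by (intro exI[of _ 1]) simp
next
  case (Neg F)
  then obtain P N :: real where *: "P > 0" "N > 0" "P * N \<le> fsize F"
    "span_witness (feval F) (fvars F) (fsize F) P N" by blast
  have "feval (Neg F) = (\<lambda>a. \<not> feval F a)" by (simp add: fun_eq_iff)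
  then have "span_witness (feval (Neg F)) (fvars (Neg F)) (fsize (Neg F)) N P"
    using span_witness_Neg[OF *(4)] by simp
  then show ?case using * by (metis fsize.simps(2) mult.commute)
next
  case (Conj F G)
  then obtain P N P' N' :: real where *: "P > 0" "N > 0" "P * N \<le> fsize F"
    "span_witness (feval F) (fvars F) (fsize F) P N" "P' > 0" "N' > 0" "P' * N' \<le> fsize G"
    "span_witness (feval G) (fvars G) (fsize G) P' N'" by blast
  have "feval (Conj F G) = (\<lambda>a. feval F a \<and> feval G a)" by (simp add: fun_eq_iff)
  then have sw: "span_witness (feval (Conj F G)) (fvars (Conj F G)) (fsize (Conj F G)) (N * P + N' * P') 1"
    using span_witness_Conj[OF *(4) *(8) *(2) *(6)] by simp
  have "N * P + N' * P' > 0" using * by (simp add: add_pos_pos)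
  moreover have "(N * P + N' * P') * 1 \<le> fsize (Conj F G)"
    using *(3,7) by (simp add: mult.commute)
  ultimately show ?case using sw zero_less_one by blast
next
  case (Disj F G)
  then obtain P N P' N' :: real where *: "P > 0" "N > 0" "P * N \<le> fsize F"
    "span_witness (feval F) (fvars F) (fsize F) P N" "P' > 0" "N' > 0" "P' * N' \<le> fsize G"
    "span_witness (feval G) (fvars G) (fsize G) P' N'" by blast
  have "feval (Disj F G) = (\<lambda>a. \<not> (\<not> feval F a \<and> \<not> feval G a))" by (simp add: fun_eq_iff)
  then have sw: "span_witness (feval (Disj F G)) (fvars (Disj F G)) (fsize (Disj F G)) 1 (P * N + P' * N')"
    using span_witness_Neg[OF span_witness_Conj[OF span_witness_Neg[OF *(4)] span_witness_Neg[OF *(8)] *(1) *(5)]]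
    by simp
  have "P * N + P' * N' > 0" using * by (simp add: add_pos_pos)
  moreover have "1 * (P * N + P' * N') \<le> fsize (Disj F G)"
    using *(3,7) by simp
  ultimately show ?case using sw zero_less_one by blast
qed

subsection \<open>Reflections\<close>

definition ip :: "'i set \<Rightarrow> ('i \<Rightarrow> real) \<Rightarrow> ('i \<Rightarrow> real) \<Rightarrow> real" where
  "ip J v w = (\<Sum>q\<in>J. v q * w q)"

definition mat_app :: "'i set \<Rightarrow> ('i \<Rightarrow> 'i \<Rightarrow> real) \<Rightarrow> ('i \<Rightarrow> real) \<Rightarrow> 'i \<Rightarrow> real" where
  "mat_app J K w q = (\<Sum>q'\<in>J. K q q' * w q')"

lemma ip_cong: "(\<And>q. q \<in> J \<Longrightarrow> v q = v' q) \<Longrightarrow> (\<And>q. q \<in> J \<Longrightarrow> w q = w' q) \<Longrightarrow> ip J v w = ip J v' w'"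
  unfolding ip_def by (intro sum.cong) auto

lemma mat_app_cong: "(\<And>q. q \<in> J \<Longrightarrow> w q = w' q) \<Longrightarrow> mat_app J K w q = mat_app J K w' q"
  unfolding mat_app_def by (intro sum.cong) auto

lemma ip_commute: "ip J v w = ip J w v"
  unfolding ip_def by (simp add: mult.commute)

lemma ip_add_left: "ip J (\<lambda>q. v q + v' q) w = ip J v w + ip J v' w"
  unfolding ip_def by (simp add: distrib_right sum.distrib)

lemma ip_add_right: "ip J w (\<lambda>q. v q + v' q) = ip J w v + ip J w v'"
  unfolding ip_def by (simp add: distrib_left sum.distrib)

lemma ip_scale_left: "ip J (\<lambda>q. c * v q) w = c * ip J v w"
  unfolding ip_def by (simp add: sum_distrib_left mult.assoc)

lemma ip_scale_right: "ip J w (\<lambda>q. c * v q) = c * ip J w v"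
  unfolding ip_def by (simp add: sum_distrib_left algebra_simps)

lemma ip_self_nonneg: "ip J v v \<ge> 0"
  unfolding ip_def by (simp add: sum_nonneg)

lemma mat_app_add: "mat_app J K (\<lambda>q. v q + w q) = (\<lambda>q. mat_app J K v q + mat_app J K w q)"
  unfolding mat_app_def by (simp add: distrib_left sum.distrib fun_eq_iff)

lemma mat_app_scale: "mat_app J K (\<lambda>q. c * w q) = (\<lambda>q. c * mat_app J K w q)"
  unfolding mat_app_def by (simp add: sum_distrib_left algebra_simps fun_eq_iff)

definition isometry_on :: "'i set \<Rightarrow> ('i \<Rightarrow> 'i \<Rightarrow> real) \<Rightarrow> bool" where
  "isometry_on J K \<longleftrightarrow> (\<forall>w. ip J (mat_app J K w) (mat_app J K w) = ip J w w)"

text \<open>Polarization: compare the norms of \<open>v\<close>, \<open>w\<close> and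
  \<open>v + w\<close>.\<close>

lemma isometry_on_ip:
  assumes "isometry_on J K"
  shows "ip J (mat_app J K v) (mat_app J K w) = ip J v w"
proof -
  have "ip J (mat_app J K (\<lambda>q. v q + w q)) (mat_app J K (\<lambda>q. v q + w q)) =
      ip J (\<lambda>q. v q + w q) (\<lambda>q. v q + w q)"
    using assms unfolding isometry_on_def by blast
  moreover have "ip J (mat_app J K v) (mat_app J K v) = ip J v v"
    "ip J (mat_app J K w) (mat_app J K w) = ip J w w"
    using assms unfolding isometry_on_def by blast+
  ultimately show ?thesis
    by (simp add: mat_app_add ip_add_left ip_add_right ip_commute[of J w v]
        ip_commute[of J "mat_app J K w" "mat_app J K v"])
qed

text \<open>A column of \<open>K\<close> is the image of a basis vector and so has norm 1.\<close>

lemma isometry_on_entry_le: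
  assumes "isometry_on J K" "finite J" "q \<in> J" "p \<in> J"
  shows "\<bar>K q p\<bar> \<le> 1"
proof -
  define e where "e = (\<lambda>x. if x = p then 1 else 0 :: real)"
  have "mat_app J K e = (\<lambda>q. K q p)"
    using assms by (auto simp: mat_app_def e_def fun_eq_iff if_distrib cong: if_cong)
  moreover have "ip J e e = 1"
    using assms by (simp add: ip_def e_def if_distrib cong: if_cong)
  ultimately have "(\<Sum>q\<in>J. (K q p)\<^sup>2) = 1"
    using assms unfolding isometry_on_def ip_def by (metis (no_types, lifting) power2_eq_square sum.cong)
  moreover have "(K q p)\<^sup>2 \<le> (\<Sum>q\<in>J. (K q p)\<^sup>2)"
    using assms by (intro member_le_sum) auto
  ultimately show ?thesis by (simp add: abs_square_le_1)
qed

text \<open>The reflection is a product of Householder reflections: given the reflection \<open>K\<close> for \<open>\<Psi>\<close>,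
  the vector \<open>r = \<psi> + K \<psi>\<close> is twice the component of \<open>\<psi>\<close> orthogonal to the span of \<open>\<Psi>\<close>.\<close>

lemma exists_reflection:
  assumes "finite J" "finite \<Psi>"
  shows "\<exists>K. isometry_on J K \<and> (\<forall>\<psi>\<in>\<Psi>. \<forall>q\<in>J. mat_app J K \<psi> q = - \<psi> q) \<and>
    (\<forall>\<phi>. (\<forall>\<psi>\<in>\<Psi>. ip J \<psi> \<phi> = 0) \<longrightarrow> (\<forall>q\<in>J. mat_app J K \<phi> q = \<phi> q))"
  using assms(2)
proof (induction \<Psi> rule: finite_induct)
  case empty
  have "mat_app J (\<lambda>q p. if q = p then 1 else 0) w q = w q" if "q \<in> J" for w q
    using that assms(1) by (simp add: mat_app_def if_distrib[of "\<lambda>x. x * _"] cong: if_cong)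
  then show ?case
    unfolding isometry_on_def
    by (intro exI[of _ "\<lambda>q p. if q = p then 1 else 0"] conjI) (auto intro!: ip_cong)
next
  case (insert \<psi> \<Psi>)
  then obtain K where iso: "isometry_on J K"
    and neg: "\<And>\<psi> q. \<psi> \<in> \<Psi> \<Longrightarrow> q \<in> J \<Longrightarrow> mat_app J K \<psi> q = - \<psi> q"
    and fixd: "\<And>\<phi> q. (\<And>\<psi>. \<psi> \<in> \<Psi> \<Longrightarrow> ip J \<psi> \<phi> = 0) \<Longrightarrow> q \<in> J \<Longrightarrow> mat_app J K \<phi> q = \<phi> q"
    by blast
  define r where "r = (\<lambda>q. \<psi> q + mat_app J K \<psi> q)"
  \<comment> \<open>If \<open>r\<close> vanishes on \<open>J\<close>, division by zero gives
    \<open>c = 0\<close>, so no new reflection is made; then \<open>K\<close> negates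
    \<open>\<psi>\<close> already.\<close>
  define c where "c = 2 / ip J r r"
  define K' where "K' = (\<lambda>q p. K q p - c * r q * (\<Sum>t\<in>J. r t * K t p))"
  have app: "mat_app J K' w q = mat_app J K w q + (- c * ip J r (mat_app J K w)) * r q" for w q
  proof -
    have "(\<Sum>p\<in>J. (\<Sum>t\<in>J. r t * K t p) * w p) = ip J r (mat_app J K w)"
      unfolding ip_def mat_app_def sum_distrib_left sum_distrib_right
      by (subst sum.swap) (simp add: mult.assoc)
    then show ?thesis
      unfolding K'_def mat_app_def
      by (simp add: algebra_simps sum_subtractf sum_distrib_left flip: sum_distrib_left)
  qed
  have c0: "c * c * ip J r r = 2 * c"
    by (cases "ip J r r = 0") (auto simp: c_def)
  have iso': "isometry_on J K'"
    unfolding isometry_on_def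
  proof
    fix w
    let ?t = "ip J r (mat_app J K w)"
    have "ip J (mat_app J K' w) (mat_app J K' w) =
       ip J (mat_app J K w) (mat_app J K w) - 2 * c * ?t * ?t + c * c * ip J r r * ?t * ?t"
      unfolding app
      by (simp only: ip_add_left ip_add_right ip_scale_left ip_scale_right ip_commute[of J "mat_app J K w" r])
         (simp add: algebra_simps)
    also have "\<dots> = ip J w w" using iso c0 by (simp add: isometry_on_def)
    finally show "ip J (mat_app J K' w) (mat_app J K' w) = ip J w w" .
  qed
  have rK: "ip J r w = ip J \<psi> w + ip J (mat_app J K \<psi>) w" for w
    unfolding r_def by (simp add: ip_add_left)
  \<comment> \<open>The two summands of \<open>r\<close> contribute opposite values:
    \<open>K\<close> negates \<open>\<theta>\<close>, but preserves the inner product of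
    \<open>\<psi>\<close> and \<open>\<theta>\<close>.\<close>
  have r_old: "ip J r (mat_app J K \<theta>) = 0" if "\<theta> \<in> \<Psi>" for \<theta>
  proof -
    have "ip J \<psi> (mat_app J K \<theta>) = ip J \<psi> (\<lambda>q. (-1) * \<theta> q)"
      using neg[OF that] by (intro ip_cong) auto
    then show ?thesis
      unfolding rK isometry_on_ip[OF iso] by (simp only: ip_scale_right)
  qed
  have r_new: "mat_app J K' \<psi> q = - \<psi> q" if "q \<in> J" for q
  proof (cases "ip J r r = 0")
    case True
    then have "(\<Sum>q\<in>J. (r q)\<^sup>2) = 0" by (simp add: ip_def power2_eq_square)
    then have "r q = 0" using assms(1) that by (simp add: sum_nonneg_eq_0_iff)
    then show ?thesis unfolding app by (simp add: r_def)
  next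
    case False
    have e: "ip J r (mat_app J K \<psi>) = ip J \<psi> \<psi> + ip J \<psi> (mat_app J K \<psi>)"
      unfolding rK isometry_on_ip[OF iso] by simp
    \<comment> \<open>\<open>K \<psi>\<close> has inner product with \<open>r\<close> equal to half
      the squared norm of \<open>r\<close>, so the new reflection sends \<open>K \<psi>\<close> to
      \<open>K \<psi> - r = - \<psi>\<close>.\<close>
    have "ip J r r = 2 * ip J \<psi> \<psi> + 2 * ip J \<psi> (mat_app J K \<psi>)"
      unfolding rK by (simp add: r_def ip_add_right isometry_on_ip[OF iso] ip_commute[of J "mat_app J K \<psi>" \<psi>])
    then have "c * ip J r (mat_app J K \<psi>) = 1"
      using False by (simp add: e c_def)
    then show ?thesis unfolding app by (simp add: r_def)
  qed
  show ?case
  proof (intro exI[of _ K'] conjI ballI allI impI)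
    show "isometry_on J K'" by fact
    show "mat_app J K' \<theta> q = - \<theta> q" if "\<theta> \<in> insert \<psi> \<Psi>" "q \<in> J" for \<theta> q
      using that r_new neg r_old by (cases "\<theta> = \<psi>") (auto simp: app)
    show "mat_app J K' \<phi> q = \<phi> q" if o: "\<forall>\<theta>\<in>insert \<psi> \<Psi>. ip J \<theta> \<phi> = 0" and q: "q \<in> J" for \<phi> q
    proof -
      have f: "mat_app J K \<phi> q = \<phi> q" if "q \<in> J" for q
        using fixd[of \<phi>] o that by auto
      have "ip J \<psi> (mat_app J K \<phi>) = ip J \<psi> \<phi>"
        using f by (intro ip_cong) auto
      then have "ip J r (mat_app J K \<phi>) = 0"
        unfolding rK isometry_on_ip[OF iso] using o by simp
      then show ?thesis using f q by (simp add: app)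
    qed
  qed
qed

subsection \<open>Polynomials in signs\<close>

text \<open>Here \<open>d\<close> bounds the degree and \<open>M\<close> the sum of the absolute values of the coefficients.\<close>

inductive sign_poly :: "nat set \<Rightarrow> nat \<Rightarrow> real \<Rightarrow> ((nat \<Rightarrow> bool) \<Rightarrow> real) \<Rightarrow> bool"
  for V where
  const: "\<bar>c\<bar> \<le> M \<Longrightarrow> sign_poly V d M (\<lambda>a. c)"
| sign: "i \<in> V \<Longrightarrow> sign_poly V d M h \<Longrightarrow> sign_poly V (Suc d) M (\<lambda>a. sg (a i) * h a)"
| add: "sign_poly V d M h \<Longrightarrow> sign_poly V d M' h' \<Longrightarrow> sign_poly V d (M + M') (\<lambda>a. h a + h' a)"

lemma sign_poly_nonneg: "sign_poly V d M h \<Longrightarrow> 0 \<le> M"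
  by (induction rule: sign_poly.induct) auto

lemma sign_poly_weaken:
  "sign_poly V d M h \<Longrightarrow> d \<le> d' \<Longrightarrow> M \<le> M' \<Longrightarrow> sign_poly V d' M' h"
proof (induction arbitrary: d' M' rule: sign_poly.induct)
  case (const c M d)
  then show ?case by (intro sign_poly.const) auto
next
  case (sign i d M h)
  then obtain e where "d' = Suc e" "d \<le> e" by (cases d') auto
  then show ?case using sign by (auto intro!: sign_poly.sign)
next
  case (add d M1 h1 M2 h2)
  have "sign_poly V d' (M1 + (M' - M1)) (\<lambda>a. h1 a + h2 a)"
    using add by (intro sign_poly.add) auto
  then show ?case by simp
qed

lemma sign_poly_scale:
  "sign_poly V d M h \<Longrightarrow> sign_poly V d (\<bar>c\<bar> * M) (\<lambda>a. c * h a)"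
proof (induction rule: sign_poly.induct)
  case (const c' M d)
  then show ?case by (intro sign_poly.const) (simp add: abs_mult mult_left_mono)
next
  case (sign i d M h)
  have "sign_poly V (Suc d) (\<bar>c\<bar> * M) (\<lambda>a. sg (a i) * (c * h a))"
    using sign by (intro sign_poly.sign) auto
  then show ?case by (simp add: algebra_simps)
next
  case (add d M1 h1 M2 h2)
  then show ?case using sign_poly.add[OF add.IH] by (simp add: algebra_simps)
qed

lemma sign_poly_mult:
  assumes "sign_poly V d M h" and g: "sign_poly V d' M' g"
  shows "sign_poly V (d + d') (M * M') (\<lambda>a. h a * g a)"
  using assms(1)
proof (induction rule: sign_poly.induct)
  case (const c M d)
  show ?case
    using sign_poly_nonneg[OF g] const
    by (intro sign_poly_weaken[OF sign_poly_scale[OF g]] mult_right_mono) auto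
next
  case (sign i d M h)
  have "sign_poly V (Suc (d + d')) (M * M') (\<lambda>a. sg (a i) * (h a * g a))"
    using sign by (intro sign_poly.sign) auto
  then show ?case by (simp add: algebra_simps)
next
  case (add d M1 h1 M2 h2)
  then show ?case using sign_poly.add[OF add.IH] by (simp add: algebra_simps)
qed

lemma sign_poly_power:
  "sign_poly V d M h \<Longrightarrow> sign_poly V (n * d) (M ^ n) (\<lambda>a. h a ^ n)"
proof (induction n)
  case 0
  show ?case using sign_poly.const[of 1 1 V 0] by simp
next
  case (Suc n)
  then show ?case using sign_poly_mult[OF Suc.prems Suc.IH] by simp
qed

lemma sign_poly_sum:
  assumes "finite X" "\<And>i. i \<in> X \<Longrightarrow> sign_poly V d (M i) (h i)"
  shows "sign_poly V d (\<Sum>i\<in>X. M i) (\<lambda>a. \<Sum>i\<in>X. h i a)"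
  using assms
proof (induction X rule: finite_induct)
  case empty
  show ?case using sign_poly.const[of 0 0 V d] by simp
next
  case (insert x X)
  then show ?case using sign_poly.add[of V d "M x" "h x" "sum M X"] by simp
qed

lemma sign_poly_mono_vars:
  "sign_poly V d M h \<Longrightarrow> V \<subseteq> V' \<Longrightarrow> sign_poly V' d M h"
proof (induction rule: sign_poly.induct)
  case (const c M d)
  then show ?case by (intro sign_poly.const)
next
  case (sign i d M h)
  then show ?case by (intro sign_poly.sign) auto
next
  case (add d M1 h1 M2 h2)
  then show ?case by (intro sign_poly.add)
qed

subsection \<open>Approximating a formula by averaging a walk\<close>

text \<open>A linear isometry in abstract form. Vectors are total functions, and \<open>cong\<close>
  makes their values outside \<open>J\<close> irrelevant.\<close>

locale walk =
  fixes J :: "'i set" and U :: "('i \<Rightarrow> real) \<Rightarrow> 'i \<Rightarrow> real" and z :: 'i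
  assumes fin: "finite J" and z: "z \<in> J"
    and lin: "U (\<lambda>q. x q + c * y q) = (\<lambda>q. U x q + c * U y q)"
    and cong: "(\<And>q. q \<in> J \<Longrightarrow> x q = y q) \<Longrightarrow> U x = U y"
    and iso: "ip J (U x) (U x) = ip J x x"
begin

definition e :: "'i \<Rightarrow> real" where
  "e q = (if q = z then 1 else 0)"

lemma pow_lin: "(U ^^ n) (\<lambda>q. x q + c * y q) = (\<lambda>q. (U ^^ n) x q + c * (U ^^ n) y q)"
  by (induction n) (simp_all add: lin)

lemma pow_cong: "(\<And>q. q \<in> J \<Longrightarrow> x q = y q) \<Longrightarrow> q \<in> J \<Longrightarrow> (U ^^ n) x q = (U ^^ n) y q"
proof (induction n arbitrary: q)
  case (Suc n)
  then have "U ((U ^^ n) x) = U ((U ^^ n) y)" by (intro cong) auto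
  then show ?case by simp
qed auto

lemma pow_iso: "ip J ((U ^^ n) x) ((U ^^ n) x) = ip J x x"
  by (induction n) (simp_all add: iso)

lemma coord_le: "\<bar>(U ^^ n) x z\<bar> \<le> sqrt (ip J x x)"
proof -
  have "((U ^^ n) x z)\<^sup>2 \<le> ip J ((U ^^ n) x) ((U ^^ n) x)"
    unfolding ip_def power2_eq_square
    by (rule member_le_sum[of z J "\<lambda>q. (U ^^ n) x q * (U ^^ n) x q"]) (auto simp: fin z)
  then show ?thesis by (simp add: pow_iso real_le_rsqrt flip: real_sqrt_abs)
qed

text \<open>Write \<open>e = \<phi> - \<eta>\<close>. The fixed vector contributes exactly 1 at
  \<open>z\<close> in every iterate, and the iterates of \<open>\<eta>\<close> contribute at most
  its norm.\<close>

lemma average_fixed: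
  assumes fx: "\<And>q. q \<in> J \<Longrightarrow> U \<phi> q = \<phi> q" and 1: "\<phi> z = 1" and "T > 0"
  shows "\<bar>(1 / real T) * (\<Sum>j<T. (U ^^ j) e z) - 1\<bar> \<le> sqrt (ip J (\<lambda>q. \<phi> q - e q) (\<lambda>q. \<phi> q - e q))"
    (is "_ \<le> ?B")
proof -
  define \<eta> where "\<eta> = (\<lambda>q. \<phi> q - e q)"
  have fx': "(U ^^ n) \<phi> q = \<phi> q" if "q \<in> J" for n q
    using that
  proof (induction n arbitrary: q)
    case (Suc n)
    then have "U ((U ^^ n) \<phi>) = U \<phi>" by (intro cong) auto
    then show ?case using fx Suc by simp
  qed auto
  have "(U ^^ j) e z = 1 - (U ^^ j) \<eta> z" for j
  proof -
    have "e = (\<lambda>q. \<phi> q + (-1) * \<eta> q)" by (simp add: \<eta>_def)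
    then have "(U ^^ j) e z = (U ^^ j) \<phi> z + (-1) * (U ^^ j) \<eta> z" using pow_lin by metis
    then show ?thesis using fx' z 1 by simp
  qed
  then have "(\<Sum>j<T. (U ^^ j) e z) = real T - (\<Sum>j<T. (U ^^ j) \<eta> z)"
    by (simp add: sum_subtractf)
  then have "(1 / real T) * (\<Sum>j<T. (U ^^ j) e z) - 1 = - ((\<Sum>j<T. (U ^^ j) \<eta> z) / real T)"
    using \<open>T > 0\<close> by (simp add: diff_divide_distrib)
  then have "\<bar>(1 / real T) * (\<Sum>j<T. (U ^^ j) e z) - 1\<bar> = \<bar>\<Sum>j<T. (U ^^ j) \<eta> z\<bar> / real T"
    by (simp only: abs_minus_cancel abs_divide abs_of_nat)
  also have "\<dots> \<le> (\<Sum>j<T. ?B) / real T"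
    using coord_le[of _ \<eta>] by (intro divide_right_mono order.trans[OF sum_abs] sum_mono) (auto simp: \<eta>_def)
  also have "\<dots> = ?B" using \<open>T > 0\<close> by simp
  finally show ?thesis .
qed

text \<open>Since \<open>2 e = \<psi> - U \<psi>\<close>, the sum of the iterates of \<open>e\<close> telescopes.\<close>

lemma average_flip:
  assumes fl: "\<And>q. q \<in> J \<Longrightarrow> U \<psi> q = \<psi> q - 2 * e q" and "T > 0"
  shows "\<bar>(1 / real T) * (\<Sum>j<T. (U ^^ j) e z)\<bar> \<le> sqrt (ip J \<psi> \<psi>) / real T"
proof -
  have "(U ^^ Suc n) \<psi> z = (U ^^ n) \<psi> z - 2 * (U ^^ n) e z" for n
  proof -
    have "(U ^^ Suc n) \<psi> z = (U ^^ n) (U \<psi>) z" by (simp only: funpow_Suc_right o_def)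
    also have "\<dots> = (U ^^ n) (\<lambda>q. \<psi> q + (-2) * e q) z"
      using fl z by (intro pow_cong) auto
    also have "\<dots> = (U ^^ n) \<psi> z - 2 * (U ^^ n) e z" unfolding pow_lin by simp
    finally show ?thesis .
  qed
  then have tel: "2 * (U ^^ n) e z = (U ^^ n) \<psi> z - (U ^^ Suc n) \<psi> z" for n
    by simp
  have sum: "2 * (\<Sum>j<n. (U ^^ j) e z) = \<psi> z - (U ^^ n) \<psi> z" for n
  proof (induction n)
    case (Suc n)
    then show ?case using tel[of n] by (simp only: sum.lessThan_Suc distrib_left)
  qed simp
  have "\<bar>\<psi> z - (U ^^ T) \<psi> z\<bar> \<le> 2 * sqrt (ip J \<psi> \<psi>)"
    using coord_le[of 0 \<psi>] coord_le[of T \<psi>] by simp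
  then have "\<bar>\<Sum>j<T. (U ^^ j) e z\<bar> \<le> sqrt (ip J \<psi> \<psi>)"
    unfolding sum[of T, symmetric] abs_mult by simp
  then have "\<bar>\<Sum>j<T. (U ^^ j) e z\<bar> / real T \<le> sqrt (ip J \<psi> \<psi>) / real T"
    by (rule divide_right_mono) simp
  moreover have "\<bar>(1 / real T) * (\<Sum>j<T. (U ^^ j) e z)\<bar> = \<bar>\<Sum>j<T. (U ^^ j) e z\<bar> / real T"
    by (simp only: abs_mult abs_divide abs_one abs_of_nat mult_1_left times_divide_eq_left)
  ultimately show ?thesis by (simp only:)
qed

end

text \<open>\<open>None\<close> is the start state; \<open>Some (l, b)\<close> asserts that the variable read at leaf \<open>l\<close> has value \<open>b\<close>.\<close>

definition qbasis :: "nat \<Rightarrow> (nat \<times> bool) option set" where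
  "qbasis r = insert None (Some ` ({..<r} \<times> UNIV))"

lemma finite_qbasis [simp]: "finite (qbasis r)"
  by (simp add: qbasis_def)

lemma sum_qbasis:
  fixes h :: "(nat \<times> bool) option \<Rightarrow> real"
  shows "(\<Sum>q\<in>qbasis r. h q) = h None + (\<Sum>l<r. h (Some (l, False)) + h (Some (l, True)))"
proof -
  have "(\<Sum>q\<in>qbasis r. h q) = h None + (\<Sum>q\<in>Some ` ({..<r} \<times> UNIV). h q)"
    unfolding qbasis_def by (subst sum.insert) auto
  also have "(\<Sum>q\<in>Some ` ({..<r} \<times> UNIV). h q) = (\<Sum>l<r. \<Sum>b\<in>UNIV. h (Some (l, b)))"
    by (subst sum.reindex) (auto simp: sum.cartesian_product)
  finally show ?thesis by (simp add: UNIV_bool)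
qed

lemma card_qbasis: "card (qbasis r) = 2 * r + 1"
  unfolding qbasis_def by (subst card_insert_disjoint) (auto simp: card_image)

text \<open>The diagonal reflection that keeps the start state and the assertions true for
  \<open>a\<close> and negates the false ones. Written with signs, it has degree at most one in the
  input.\<close>

definition query :: "(nat \<Rightarrow> nat) \<Rightarrow> (nat \<Rightarrow> bool) \<Rightarrow> (nat \<times> bool) option \<Rightarrow> real" where
  "query w a q = (case q of None \<Rightarrow> 1 | Some (l, b) \<Rightarrow> sg (a (w l)) * sg b)"

definition step where
  "step r K w a x q = query w a q * mat_app (qbasis r) K x q"

text \<open>Each step sums \<open>2 * r + 1\<close> coordinates with matrix entries of absolute
  value at most 1 and multiplies by at most one input sign. So the degree grows by one and the
  coefficient bound by the dimension.\<close>

lemma sign_poly_step: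
  assumes K: "isometry_on (qbasis r) K" and w: "\<And>l. l < r \<Longrightarrow> w l \<in> V"
    and x: "\<And>q. \<bar>x q\<bar> \<le> 1" and "q \<in> qbasis r"
  shows "sign_poly V j (real (2 * r + 1) ^ j) (\<lambda>a. (step r K w a ^^ j) x q)"
  using assms(4)
proof (induction j arbitrary: q)
  case 0
  show ?case using x by (auto intro: sign_poly.const)
next
  case (Suc j)
  let ?N = "real (2 * r + 1)"
  have M: "sign_poly V j (?N ^ Suc j) (\<lambda>a. mat_app (qbasis r) K ((step r K w a ^^ j) x) q)"
  proof (rule sign_poly_weaken[OF _ order.refl])
    show "sign_poly V j (\<Sum>p\<in>qbasis r. \<bar>K q p\<bar> * ?N ^ j)
      (\<lambda>a. mat_app (qbasis r) K ((step r K w a ^^ j) x) q)"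
      unfolding mat_app_def by (intro sign_poly_sum sign_poly_scale Suc.IH) auto
    have "(\<Sum>p\<in>qbasis r. \<bar>K q p\<bar> * ?N ^ j) \<le> (\<Sum>p\<in>qbasis r. 1 * ?N ^ j)"
      using isometry_on_entry_le[OF K _ Suc.prems] by (intro sum_mono mult_right_mono) auto
    also have "\<dots> = ?N ^ Suc j" by (simp add: card_qbasis)
    finally show "(\<Sum>p\<in>qbasis r. \<bar>K q p\<bar> * ?N ^ j) \<le> ?N ^ Suc j" .
  qed
  show ?case
  proof (cases q)
    case None
    then have "(step r K w a ^^ Suc j) x q = mat_app (qbasis r) K ((step r K w a ^^ j) x) q" for a
      by (simp add: step_def[of r K w a "(step r K w a ^^ j) x"] query_def)
    then show ?thesis using sign_poly_weaken[OF M, of "Suc j"] by simp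
  next
    case (Some lb)
    obtain l b where lb: "lb = (l, b)" by force
    have "w l \<in> V" using Some lb Suc.prems w by (auto simp: qbasis_def)
    moreover have "(step r K w a ^^ Suc j) x q =
        sg (a (w l)) * (sg b * mat_app (qbasis r) K ((step r K w a ^^ j) x) q)" for a
      by (simp add: step_def[of r K w a "(step r K w a ^^ j) x"] query_def Some lb)
    ultimately show ?thesis
      using sign_poly.sign[OF _ sign_poly_scale[OF M, of "sg b"]] by simp
  qed
qed

lemma walk_step:
  assumes K: "isometry_on (qbasis r) K"
  shows "walk (qbasis r) (step r K w a) None"
proof
  show "finite (qbasis r)" by simp
  show "None \<in> qbasis r" by (simp add: qbasis_def)
  show "step r K w a (\<lambda>q. x q + c * y q) = (\<lambda>q. step r K w a x q + c * step r K w a y q)" for x c y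
    unfolding step_def mat_app_add mat_app_scale by (simp add: algebra_simps fun_eq_iff)
  show "step r K w a x = step r K w a y" if "\<And>q. q \<in> qbasis r \<Longrightarrow> x q = y q" for x y
    unfolding step_def using mat_app_cong[where J="qbasis r", OF that] by (simp add: fun_eq_iff)
  show "ip (qbasis r) (step r K w a x) (step r K w a x) = ip (qbasis r) x x" for x
  proof -
    have "query w a q * query w a q = 1" for q
      by (auto simp: query_def sg_def split: option.splits)
    moreover have "step r K w a x q * step r K w a x q = (query w a q * query w a q) *
        (mat_app (qbasis r) K x q * mat_app (qbasis r) K x q)" for q
      unfolding step_def by (simp only: ac_simps)
    ultimately have "step r K w a x q * step r K w a x q =
        mat_app (qbasis r) K x q * mat_app (qbasis r) K x q" for q by (simp only: mult_1_left)
    then show ?thesis using K unfolding isometry_on_def ip_def by simp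
  qed
qed

text \<open>Let \<open>K\<close> reflect the vectors \<open>\<psi> b\<close> of the rejected
  \<open>b\<close> in \<open>A\<close>; finiteness of \<open>A\<close> keeps their number finite.
  For accepted \<open>a\<close>, the vector \<open>\<phi> a\<close> is fixed by \<open>K\<close> and
  by the query, and it is close to the start state. For rejected \<open>a\<close>, the walk shifts
  \<open>\<psi> a\<close> by twice the start state. Averaging separates the two cases.\<close>

lemma formula_approx:
  fixes F :: dmformula and A :: "(nat \<Rightarrow> bool) set"
  assumes A: "finite A" and T: "real T \<ge> 400 * sqrt (fsize F)"
  shows "\<exists>p. sign_poly (fvars F) T (real (2 * fsize F + 1) ^ T) p \<and>
    (\<forall>a\<in>A. \<bar>p a - of_bool (feval F a)\<bar> \<le> 1 / 16)"
proof -
  define r where "r = fsize F"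
  obtain P N :: real where PN: "P > 0" "N > 0" "P * N \<le> r" and "span_witness (feval F) (fvars F) r P N"
    using span_witness_formula[of F] unfolding r_def by blast
  then obtain w u v where w: "\<And>l. l < r \<Longrightarrow> w l \<in> fvars F"
     and u: "\<And>a. feval F a \<Longrightarrow> (\<Sum>l<r. (u a l)\<^sup>2) \<le> P"
     and v: "\<And>b. \<not> feval F b \<Longrightarrow> (\<Sum>l<r. (v b l)\<^sup>2) \<le> N"
     and uv: "\<And>a b. feval F a \<Longrightarrow> \<not> feval F b \<Longrightarrow>
        (\<Sum>l<r. if a (w l) \<noteq> b (w l) then u a l * v b l else 0) = (1::real)"
    unfolding span_witness_def by blast
  have r: "r \<ge> 1" unfolding r_def by (induction F) auto
  then have T0: "T > 0" using T unfolding r_def[symmetric] by (cases T) auto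
  \<comment> \<open>This weight puts \<open>\<phi> a\<close> within 1/16 of the start state. The
    price is a norm of \<open>\<psi> b\<close> up to
    \<open>sqrt (1 + 256 * r) <= 25 * sqrt r\<close>, and 25/400 = 1/16 explains the constant in the
    bound on \<open>T\<close>.\<close>
  define \<alpha> where "\<alpha> = 1 / (16 * sqrt P)"
  have \<alpha>: "\<alpha> > 0" using PN by (simp add: \<alpha>_def)
  have \<alpha>2: "\<alpha>\<^sup>2 = 1 / (256 * P)" using PN by (simp add: \<alpha>_def power_divide power_mult_distrib)
  \<comment> \<open>Apart from the start state, \<open>\<psi> b\<close> lives on the assertions
    false for \<open>b\<close> and \<open>\<phi> a\<close> on those true for \<open>a\<close>. They
    meet only at leaves where \<open>a\<close> and \<open>b\<close> differ, so the inner product is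
    1 - 1 = 0 by the span program identity.\<close>
  define \<psi> where "\<psi> b q = (case q of None \<Rightarrow> 1 | Some (l, c) \<Rightarrow>
      if c = b (w l) then 0 else - v b l / \<alpha>)" for b q
  define \<phi> where "\<phi> a q = (case q of None \<Rightarrow> 1 | Some (l, c) \<Rightarrow>
      if c = a (w l) then \<alpha> * u a l else 0)" for a q
  obtain K where iso: "isometry_on (qbasis r) K"
    and K\<psi>: "\<And>b q. b \<in> A \<Longrightarrow> \<not> feval F b \<Longrightarrow> q \<in> qbasis r \<Longrightarrow> mat_app (qbasis r) K (\<psi> b) q = - \<psi> b q"
    and K\<phi>: "\<And>x q. (\<And>b. b \<in> A \<Longrightarrow> \<not> feval F b \<Longrightarrow> ip (qbasis r) (\<psi> b) x = 0) \<Longrightarrow>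
       q \<in> qbasis r \<Longrightarrow> mat_app (qbasis r) K x q = x q"
    using exists_reflection[of "qbasis r" "\<psi> ` {b \<in> A. \<not> feval F b}"] A by auto
  have orth: "ip (qbasis r) (\<psi> b) (\<phi> a) = 0" if "feval F a" "\<not> feval F b" for a b
  proof -
    have "(\<Sum>l<r. \<psi> b (Some (l, False)) * \<phi> a (Some (l, False)) +
          \<psi> b (Some (l, True)) * \<phi> a (Some (l, True))) =
      - (\<Sum>l<r. if a (w l) \<noteq> b (w l) then u a l * v b l else 0)"
      unfolding sum_negf[symmetric] using \<alpha> by (intro sum.cong) (auto simp: \<psi>_def \<phi>_def)
    then show ?thesis
      unfolding ip_def sum_qbasis using uv[OF that] by (simp add: \<psi>_def \<phi>_def)
  qed
  define e0 :: "(nat \<times> bool) option \<Rightarrow> real" where "e0 q = (if q = None then 1 else 0)" for q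
  define p where "p a = (1 / real T) * (\<Sum>j<T. (step r K w a ^^ j) e0 None)" for a
  have err: "\<bar>p a - of_bool (feval F a)\<bar> \<le> 1 / 16" if a: "a \<in> A" for a
  proof -
    interpret W: walk "qbasis r" "step r K w a" None by (rule walk_step[OF iso])
    have e0: "W.e = e0" by (simp add: W.e_def e0_def fun_eq_iff)
    show ?thesis
    proof (cases "feval F a")
      case True
      have "step r K w a (\<phi> a) q = \<phi> a q" if "q \<in> qbasis r" for q
        using K\<phi>[OF orth[OF True] that]
        by (auto simp: step_def query_def \<phi>_def sg_def split: option.splits)
      then have "\<bar>p a - 1\<bar> \<le> sqrt (ip (qbasis r) (\<lambda>q. \<phi> a q - e0 q) (\<lambda>q. \<phi> a q - e0 q))"
        unfolding p_def e0[symmetric] using T0 by (intro W.average_fixed) (auto simp: \<phi>_def[of a None])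
      also have "ip (qbasis r) (\<lambda>q. \<phi> a q - e0 q) (\<lambda>q. \<phi> a q - e0 q) = \<alpha>\<^sup>2 * (\<Sum>l<r. (u a l)\<^sup>2)"
        unfolding ip_def sum_qbasis sum_distrib_left
        by (simp add: \<phi>_def e0_def, intro sum.cong)
           (auto simp: power2_eq_square algebra_simps)
      also have "\<dots> \<le> \<alpha>\<^sup>2 * P" using u[OF True] by (intro mult_left_mono) auto
      also have "\<dots> = (1 / 16)\<^sup>2" unfolding \<alpha>2 using PN by (simp add: power2_eq_square)
      finally show ?thesis using True by (simp add: real_sqrt_unique)
    next
      case False
      \<comment> \<open>\<open>K\<close> negates all of \<open>\<psi> a\<close>, and the query
        restores the sign on the false assertions; only the start coordinate stays flipped, from 1
        to -1.\<close>
      have "step r K w a (\<psi> a) q = \<psi> a q - 2 * e0 q" if "q \<in> qbasis r" for q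
        using K\<psi>[OF a False that]
        by (auto simp: step_def query_def \<psi>_def sg_def e0_def split: option.splits)
      then have "\<bar>p a\<bar> \<le> sqrt (ip (qbasis r) (\<psi> a) (\<psi> a)) / real T"
        unfolding p_def e0[symmetric] using T0 by (intro W.average_flip) auto
      also have "\<dots> \<le> (25 * sqrt r) / real T"
      proof (intro divide_right_mono real_le_lsqrt)
        have "ip (qbasis r) (\<psi> a) (\<psi> a) = 1 + (\<Sum>l<r. (v a l)\<^sup>2) / \<alpha>\<^sup>2"
          unfolding ip_def sum_qbasis sum_divide_distrib
          by (simp add: \<psi>_def, intro sum.cong)
             (auto simp: power2_eq_square algebra_simps)
        also have "\<dots> \<le> 1 + N / \<alpha>\<^sup>2"
          using v[OF False] by (intro add_left_mono divide_right_mono) auto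
        also have "\<dots> = 1 + 256 * (P * N)" by (simp add: \<alpha>2)
        also have "\<dots> \<le> 1 + 256 * r" using PN by simp
        also have "\<dots> \<le> (25 * sqrt r)\<^sup>2" using r by (simp add: power_mult_distrib)
        finally show "ip (qbasis r) (\<psi> a) (\<psi> a) \<le> (25 * sqrt r)\<^sup>2" .
      qed (auto simp: ip_self_nonneg)
      also have "\<dots> \<le> 1 / 16" using T T0 by (simp add: field_simps r_def)
      finally show ?thesis using False by simp
    qed
  qed
  have "sign_poly (fvars F) T (real (2 * r + 1) ^ T) p"
    unfolding p_def
  proof (rule sign_poly_weaken[OF _ order.refl])
    let ?N = "real (2 * r + 1)"
    have "sign_poly (fvars F) j (?N ^ j) (\<lambda>a. (step r K w a ^^ j) e0 None)" for j
      using iso w by (intro sign_poly_step) (auto simp: e0_def qbasis_def)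
    note sp = this
    have "sign_poly (fvars F) T (?N ^ T) (\<lambda>a. (step r K w a ^^ j) e0 None)" if "j < T" for j
      using that by (intro sign_poly_weaken[OF sp]) (auto intro!: power_increasing)
    then show "sign_poly (fvars F) T (\<bar>1 / real T\<bar> * (\<Sum>j<T. ?N ^ T))
        (\<lambda>a. (1 / real T) * (\<Sum>j<T. (step r K w a ^^ j) e0 None))"
      by (intro sign_poly_scale sign_poly_sum) auto
    show "\<bar>1 / real T\<bar> * (\<Sum>j<T. ?N ^ T) \<le> ?N ^ T" using T0 by simp
  qed
  then show ?thesis using err unfolding r_def by blast
qed

subsection \<open>Error reduction\<close>

text \<open>For \<open>t\<close> in the unit interval this is the probability of at least
  \<open>l\<close> successes in \<open>2 * l\<close> independent trials. As a polynomial it also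
  makes sense for the values slightly outside that occur here.\<close>

definition amplify :: "nat \<Rightarrow> real \<Rightarrow> real" where
  "amplify l t = (\<Sum>j=l..2*l. real (2 * l choose j) * (t ^ j * (1 - t) ^ (2 * l - j)))"

text \<open>The binomial coefficients sum to \<open>4 ^ l\<close>, and 4 * 17/256 = 17/64 is below
  1/2.\<close>

lemma binomial_tail_le:
  fixes t :: real
  assumes X: "X \<subseteq> {..2*l}"
    and B: "\<And>j. j \<in> X \<Longrightarrow> \<bar>t\<bar> ^ j * \<bar>1 - t\<bar> ^ (2 * l - j) \<le> (17 / 256) ^ l"
  shows "\<bar>\<Sum>j\<in>X. real (2 * l choose j) * (t ^ j * (1 - t) ^ (2 * l - j))\<bar> \<le> (1/2) ^ l"
proof -
  have fin: "finite X" using X finite_subset by blast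
  have "\<bar>\<Sum>j\<in>X. real (2 * l choose j) * (t ^ j * (1 - t) ^ (2 * l - j))\<bar>
    \<le> (\<Sum>j\<in>X. real (2 * l choose j) * (17 / 256) ^ l)"
    using B by (intro order.trans[OF sum_abs] sum_mono) (auto simp: abs_mult power_abs intro!: mult_left_mono)
  also have "\<dots> \<le> (\<Sum>j\<le>2*l. real (2 * l choose j) * (17 / 256) ^ l)"
    using X by (intro sum_mono2) auto
  also have "\<dots> = 4 ^ l * (17 / 256) ^ l"
    by (simp add: choose_row_sum power_mult flip: sum_distrib_right of_nat_sum)
  also have "\<dots> = (17 / 64) ^ l" by (simp flip: power_mult_distrib)
  also have "\<dots> \<le> (1/2) ^ l" by (intro power_mono) auto
  finally show ?thesis .
qed

lemma small_power_mult_le: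
  fixes x y :: real
  assumes "\<bar>x\<bar> \<le> 1/16" "\<bar>y\<bar> \<le> 17/16" "l \<le> i" "j \<le> l"
  shows "\<bar>x\<bar> ^ i * \<bar>y\<bar> ^ j \<le> (17 / 256) ^ l"
proof -
  have "\<bar>x\<bar> ^ i \<le> (1/16) ^ i" using assms by (intro power_mono) auto
  also have "\<dots> \<le> (1/16) ^ l" using assms by (intro power_decreasing) auto
  finally have x: "\<bar>x\<bar> ^ i \<le> (1/16) ^ l" .
  have "\<bar>y\<bar> ^ j \<le> (17/16) ^ j" using assms by (intro power_mono) auto
  also have "\<dots> \<le> (17/16) ^ l" using assms by (intro power_increasing) auto
  finally have "\<bar>x\<bar> ^ i * \<bar>y\<bar> ^ j \<le> (1/16) ^ l * (17/16) ^ l"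
    using x by (intro mult_mono) auto
  then show ?thesis by (simp flip: power_mult_distrib)
qed

lemma amplify_error:
  assumes t: "\<bar>t - of_bool b\<bar> \<le> 1/16"
  shows "\<bar>amplify l t - of_bool b\<bar> \<le> (1/2) ^ l"
proof (cases b)
  case False
  then have "\<bar>t\<bar> \<le> 1/16" "\<bar>1 - t\<bar> \<le> 17/16" using t by auto
  then show ?thesis
    unfolding amplify_def using False
    by (auto intro!: binomial_tail_le small_power_mult_le)
next
  case True
  then have "\<bar>t - 1\<bar> \<le> 1/16" using t by simp
  then have *: "\<bar>1 - t\<bar> \<le> 1/16" "\<bar>t\<bar> \<le> 17/16" by linarith+
  \<comment> \<open>The full binomial sum is 1, so the error is the lower tail, in which
    \<open>1 - t\<close> is the small quantity with exponent above \<open>l\<close>.\<close>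
  have "(\<Sum>j\<le>2*l. real (2 * l choose j) * (t ^ j * (1 - t) ^ (2 * l - j))) = (t + (1 - t)) ^ (2 * l)"
    unfolding binomial_ring by (simp add: mult.assoc)
  moreover have "{..2*l} = {..<l} \<union> {l..2*l}" by auto
  ultimately have "1 = (\<Sum>j<l. real (2 * l choose j) * (t ^ j * (1 - t) ^ (2 * l - j))) + amplify l t"
    unfolding amplify_def by (subst sum.union_disjoint[symmetric]) auto
  moreover have "\<bar>\<Sum>j<l. real (2 * l choose j) * (t ^ j * (1 - t) ^ (2 * l - j))\<bar> \<le> (1/2) ^ l"
  proof (rule binomial_tail_le)
    fix j assume "j \<in> {..<l}"
    then have "\<bar>1 - t\<bar> ^ (2 * l - j) * \<bar>t\<bar> ^ j \<le> (17 / 256) ^ l"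
      using * by (intro small_power_mult_le) auto
    then show "\<bar>t\<bar> ^ j * \<bar>1 - t\<bar> ^ (2 * l - j) \<le> (17 / 256) ^ l" by (simp add: mult.commute)
  qed auto
  ultimately show ?thesis using True by simp
qed

text \<open>Replacing \<open>t\<close> by \<open>M\<close> and \<open>1 - t\<close> by
  \<open>1 + M\<close> bounds the coefficients by a partial binomial expansion of
  \<open>(M + (1 + M)) ^ (2 * l)\<close>. All terms have the same total degree \<open>2 * l\<close>
  in \<open>p\<close> and \<open>1 - p\<close>.\<close>

lemma sign_poly_amplify:
  assumes p: "sign_poly V d M p"
  shows "sign_poly V (2 * l * d) ((1 + 2 * M) ^ (2 * l)) (\<lambda>a. amplify l (p a))"
proof -
  have M: "M \<ge> 0" using p by (rule sign_poly_nonneg)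
  have q: "sign_poly V d (1 + M) (\<lambda>a. 1 - p a)"
    using sign_poly.add[OF sign_poly.const[of 1 1] sign_poly_scale[OF p, of "-1"]] by simp
  have "sign_poly V (2 * l * d) (\<Sum>j=l..2*l. \<bar>real (2 * l choose j)\<bar> * (M ^ j * (1 + M) ^ (2 * l - j)))
    (\<lambda>a. amplify l (p a))"
    unfolding amplify_def
  proof (intro sign_poly_sum sign_poly_scale)
    fix j assume "j \<in> {l..2*l}"
    then have "j * d + (2 * l - j) * d = 2 * l * d" by (simp flip: add_mult_distrib)
    then show "sign_poly V (2 * l * d) (M ^ j * (1 + M) ^ (2 * l - j))
        (\<lambda>a. p a ^ j * (1 - p a) ^ (2 * l - j))"
      using sign_poly_mult[OF sign_poly_power[OF p, of j] sign_poly_power[OF q, of "2 * l - j"]] by simp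
  qed simp
  moreover have "(\<Sum>j=l..2*l. \<bar>real (2 * l choose j)\<bar> * (M ^ j * (1 + M) ^ (2 * l - j)))
     \<le> (\<Sum>j\<le>2*l. real (2 * l choose j) * (M ^ j * (1 + M) ^ (2 * l - j)))"
    unfolding abs_of_nat using M by (intro sum_mono2) auto
  moreover have "\<dots> = (M + (1 + M)) ^ (2 * l)"
    unfolding binomial_ring by (simp add: mult.assoc)
  ultimately show ?thesis by (auto elim!: sign_poly_weaken simp: algebra_simps)
qed

lemma formula_sign_approx:
  fixes F :: dmformula and A :: "(nat \<Rightarrow> bool) set"
  assumes "finite A" and "real T \<ge> 400 * sqrt (fsize F)"
  shows "\<exists>q. sign_poly (fvars F) (2 * l * T) (1 + 2 * (1 + 2 * real (2 * fsize F + 1) ^ T) ^ (2 * l)) q \<and>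
    (\<forall>a\<in>A. \<bar>q a - sg (feval F a)\<bar> \<le> 2 * (1/2) ^ l)"
proof -
  obtain p where p: "sign_poly (fvars F) T (real (2 * fsize F + 1) ^ T) p"
    and err: "\<And>a. a \<in> A \<Longrightarrow> \<bar>p a - of_bool (feval F a)\<bar> \<le> 1 / 16"
    using formula_approx[OF assms] by blast
  \<comment> \<open>The affine map \<open>1 - 2 * t\<close> takes truth values 0 and 1 to the signs
    given by \<open>sg\<close>.\<close>
  define q where "q a = 1 + (-2) * amplify l (p a)" for a
  have "sign_poly (fvars F) (2 * l * T) (1 + 2 * (1 + 2 * real (2 * fsize F + 1) ^ T) ^ (2 * l)) q"
    using sign_poly.add[OF sign_poly.const[of 1 1] sign_poly_scale[OF sign_poly_amplify[OF p, where l = l], of "-2"]]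
    unfolding q_def by simp
  moreover have "\<bar>q a - sg (feval F a)\<bar> \<le> 2 * (1/2) ^ l" if "a \<in> A" for a
    using amplify_error[OF err[OF that], of l] by (cases "feval F a") (auto simp: q_def sg_def abs_le_iff)
  ultimately show ?thesis by blast
qed

subsection \<open>Correlation of the generalized inner product with cylinder functions\<close>

fun tuples :: "'b set \<Rightarrow> nat \<Rightarrow> 'b list set" where
  "tuples P 0 = {[]}"
| "tuples P (Suc k) = (\<lambda>(y, ys). y # ys) ` (P \<times> tuples P k)"

lemma in_tuples: "xs \<in> tuples P k \<longleftrightarrow> length xs = k \<and> set xs \<subseteq> P"
  by (induction k arbitrary: xs) (auto simp: length_Suc_conv image_iff)

lemma finite_tuples [simp]: "finite P \<Longrightarrow> finite (tuples P k)"
  by (induction k) auto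

lemma card_tuples: "finite P \<Longrightarrow> card (tuples P k) = card P ^ k"
  by (induction k) (auto simp: card_image inj_on_def card_cartesian_product)

lemma sum_tuples_Suc:
  fixes h :: "'b list \<Rightarrow> real"
  shows "(\<Sum>xs\<in>tuples P (Suc k). h xs) = (\<Sum>ys\<in>tuples P k. \<Sum>y\<in>P. h (y # ys))"
  by (subst sum.swap) (simp add: sum.reindex inj_on_def sum.cartesian_product case_prod_beta)

text \<open>A block is identified with the set of columns in which it has a 1, so that the inner product of
  a list of blocks is the parity of the size of their intersection.\<close>

definition parity :: "nat set \<Rightarrow> real" where
  "parity A = (-1) ^ card A"

lemma parity_sym_diff:
  assumes "finite A" "finite B"
  shows "parity A * parity B = parity (sym_diff A B)"
proof -
  have A: "card A = card (A - B) + card (A \<inter> B)"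
    using assms by (metis Int_Diff_disjoint Un_Diff_Int  card_Un_disjoint finite_Diff finite_Int inf_commute)
  have B: "card B = card (B - A) + card (A \<inter> B)"
    using assms by (metis Int_Diff_disjoint Un_Diff_Int  card_Un_disjoint finite_Diff finite_Int inf_commute)
  have S: "card (sym_diff A B) = card (A - B) + card (B - A)"
    using assms by (intro card_Un_disjoint) auto
  have "parity A * parity B = parity (sym_diff A B) * ((-1) ^ card (A \<inter> B) * (-1) ^ card (A \<inter> B))"
    unfolding parity_def A B S by (simp add: power_add)
  also have "(-1::real) ^ card (A \<inter> B) * (-1) ^ card (A \<inter> B) = 1"
    by (simp flip: power_mult_distrib)
  finally show ?thesis by simp
qed

text \<open>For uniform \<open>z\<close> the memberships of the elements are independent, and each
  element of \<open>c\<close> contributes a factor of mean \<open>(1 + \<rho>) / 2\<close>.\<close>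

lemma sum_Pow_power_card:
  fixes \<rho> :: real
  assumes "finite S" "c \<subseteq> S"
  shows "(\<Sum>z\<in>Pow S. \<rho> ^ card (c \<inter> z)) = 2 ^ card S * ((1 + \<rho>) / 2) ^ card c"
proof -
  define f where "f j = (if j \<in> c then \<rho> else 1)" for j
  have "(\<Prod>j\<in>z. f j) = \<rho> ^ card (c \<inter> z)" if "z \<subseteq> S" for z
  proof -
    have "finite z" using that assms(1) finite_subset by blast
    then show ?thesis by (simp add: f_def prod.If_cases Int_commute)
  qed
  then have "(\<Sum>z\<in>Pow S. \<rho> ^ card (c \<inter> z)) = (\<Sum>z\<in>Pow S. (\<Prod>j\<in>z. f j) * (\<Prod>j\<in>S - z. 1))"
    by (intro sum.cong) auto
  also have "\<dots> = (\<Prod>j\<in>S. f j + 1)" by (rule prod_add[OF assms(1), symmetric])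
  also have "\<dots> = (\<Prod>j\<in>S. 2 * (if j \<in> c then (1 + \<rho>) / 2 else 1))"
    by (intro prod.cong) (auto simp: f_def)
  also have "\<dots> = 2 ^ card S * (\<Prod>j\<in>S. if j \<in> c then (1 + \<rho>) / 2 else 1)"
    by (simp add: prod.distrib)
  also have "(\<Prod>j\<in>S. if j \<in> c then (1 + \<rho>) / 2 else 1) = ((1 + \<rho>) / 2) ^ card c"
    using assms by (simp add: prod.If_cases Int_absorb1)
  finally show ?thesis .
qed

text \<open>The bounded real-valued analogue of the indicator of a cylinder intersection: factor
  \<open>i\<close> does not see block \<open>i\<close>.\<close>

definition cylinder :: "nat \<Rightarrow> ('b list \<Rightarrow> real) \<Rightarrow> bool" where
  "cylinder k h \<longleftrightarrow> (\<exists>\<phi>. (\<forall>i<k. \<forall>xs y. length xs = k \<longrightarrow> \<phi> i (xs[i := y]) = \<phi> i xs) \<and>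
     (\<forall>i xs. \<bar>\<phi> i xs\<bar> \<le> 1) \<and> (\<forall>xs. length xs = k \<longrightarrow> h xs = (\<Prod>i<k. \<phi> i xs)))"

lemma cylinder_mult:
  assumes h: "cylinder k h" and i: "i < k"
    and g: "\<And>xs y. length xs = k \<Longrightarrow> g (xs[i := y]) = g xs" "\<And>xs. \<bar>g xs\<bar> \<le> 1"
  shows "cylinder k (\<lambda>xs. g xs * h xs)"
proof -
  obtain \<phi> where p: "\<forall>i<k. \<forall>xs y. length xs = k \<longrightarrow> \<phi> i (xs[i := y]) = \<phi> i xs"
     "\<forall>i xs. \<bar>\<phi> i xs\<bar> \<le> 1" "\<forall>xs. length xs = k \<longrightarrow> h xs = (\<Prod>i<k. \<phi> i xs)"
    using h unfolding cylinder_def by blast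
  define \<theta> where "\<theta> j xs = (if j = i then g xs else 1) * \<phi> j xs" for j xs
  have "(\<Prod>j<k. \<theta> j xs) = g xs * (\<Prod>j<k. \<phi> j xs)" for xs
    unfolding \<theta>_def using i by (simp add: prod.distrib)
  moreover have "\<bar>\<theta> j xs\<bar> \<le> 1" for j xs
    using p(2) g(2)[of xs] by (auto simp: \<theta>_def abs_mult mult_le_one)
  moreover have "\<theta> j (xs[j := y]) = \<theta> j xs" if "j < k" "length xs = k" for j xs y
    using p(1) g(1) that by (auto simp: \<theta>_def)
  ultimately show ?thesis
    unfolding cylinder_def using p(3) by (intro exI[of _ \<theta>]) auto
qed

text \<open>Induction on the number of players. The factor that ignores the first block is removed by
  Cauchy--Schwarz; expanding the square leaves one player fewer, with \<open>c\<close> replaced by its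
  intersection with the symmetric difference of two independent uniform first blocks, which is
  itself uniform.\<close>

lemma parity_correlation:
  fixes S c :: "nat set" and h :: "nat set list \<Rightarrow> real"
  assumes S: "finite S" and "c \<subseteq> S" and "cylinder (Suc k) h"
  shows "\<bar>\<Sum>xs\<in>tuples (Pow S) (Suc k). parity (c \<inter> \<Inter> (set xs)) * h xs\<bar>
    \<le> (2 ^ card S) ^ Suc k * (1 - (1/4) ^ k) ^ card c"
  using assms(2,3)
proof (induction k arbitrary: c h)
  case 0
  obtain \<phi> :: "nat \<Rightarrow> nat set list \<Rightarrow> real"
    where p: "\<forall>i<Suc 0. \<forall>xs y. length xs = Suc 0 \<longrightarrow> \<phi> i (xs[i := y]) = \<phi> i xs"
     "\<forall>i xs. \<bar>\<phi> i xs\<bar> \<le> 1" "\<forall>xs. length xs = Suc 0 \<longrightarrow> h xs = (\<Prod>i<Suc 0. \<phi> i xs)"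
    using 0(2) unfolding cylinder_def by blast
  \<comment> \<open>With a single block, \<open>h\<close> is constant on the tuples. The parities
    then sum to zero unless \<open>c\<close> is empty, in agreement with the base
    \<open>1 - (1/4) ^ 0 = 0\<close>.\<close>
  have h: "h [y] = \<phi> 0 [{}]" for y
    using p(1)[rule_format, of 0 "[y]" "{}"] p(3)[rule_format, of "[y]"] by simp
  have "(\<Sum>xs\<in>tuples (Pow S) (Suc 0). parity (c \<inter> \<Inter> (set xs)) * h xs) =
    (\<Sum>y\<in>Pow S. (-1) ^ card (c \<inter> y)) * \<phi> 0 [{}]"
    unfolding sum_tuples_Suc by (simp add: h parity_def flip: sum_distrib_right)
  also have "\<dots> = (2 ^ card S * ((1 + - 1) / 2) ^ card c) * \<phi> 0 [{}]"
    by (simp only: sum_Pow_power_card[OF S 0(1)])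
  finally show ?case
    using p(2)[rule_format, of 0 "[{}]"] by (auto simp: abs_mult mult_left_le)
next
  case (Suc k)
  define P where "P = Pow S"
  define L where "L = tuples P (Suc k)"
  define \<rho> :: real where "\<rho> = 1 - (1/4) ^ k"
  define \<rho>' :: real where "\<rho>' = 1 - (1/4) ^ Suc k"
  let ?N = "2 ^ card S :: real"
  obtain \<phi> :: "nat \<Rightarrow> nat set list \<Rightarrow> real"
    where p: "\<And>i xs y. i < Suc (Suc k) \<Longrightarrow> length xs = Suc (Suc k) \<Longrightarrow> \<phi> i (xs[i := y]) = \<phi> i xs"
     "\<And>i xs. \<bar>\<phi> i xs\<bar> \<le> 1"
     "\<And>xs. length xs = Suc (Suc k) \<Longrightarrow> h xs = (\<Prod>i<Suc (Suc k). \<phi> i xs)"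
    using Suc.prems(2) unfolding cylinder_def by blast
  define g where "g y ys = (\<Prod>i<Suc k. \<phi> (Suc i) (y # ys))" for y ys
  define F where "F y ys = parity (c \<inter> y \<inter> \<Inter> (set ys)) * g y ys" for y ys
  have finP: "finite P" and cardP: "card P = 2 ^ card S"
    using S by (simp_all add: P_def card_Pow)
  have finL: "finite L" unfolding L_def using finP by (rule finite_tuples)
  have cardL: "real (card L) = ?N ^ Suc k"
    unfolding L_def card_tuples[OF finP] cardP by simp
  \<comment> \<open>Factor 0 ignores the first block, so the filler \<open>{}\<close> lets it leave
    the sum over \<open>y\<close>.\<close>
  have h: "h (y # ys) = \<phi> 0 ({} # ys) * g y ys" if "length ys = Suc k" for y ys
  proof -
    have "\<phi> 0 ({} # ys) = \<phi> 0 (y # ys)"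
      using p(1)[of 0 "y # ys" "{}"] that by simp
    then show ?thesis using p(3)[of "y # ys"] that
      by (simp add: g_def prod.lessThan_Suc_shift del: prod.lessThan_Suc)
  qed
  have gg: "cylinder (Suc k) (\<lambda>ys. g y ys * g y' ys)" for y y'
    unfolding cylinder_def
  proof (intro exI[of _ "\<lambda>i ys. \<phi> (Suc i) (y # ys) * \<phi> (Suc i) (y' # ys)"] conjI allI impI)
    fix i ys t
    show "\<bar>\<phi> (Suc i) (y # ys) * \<phi> (Suc i) (y' # ys)\<bar> \<le> 1"
      using p(2) by (simp add: abs_mult mult_le_one)
    show "g y ys * g y' ys = (\<Prod>i<Suc k. \<phi> (Suc i) (y # ys) * \<phi> (Suc i) (y' # ys))"
      by (simp add: g_def prod.distrib)
    show "\<phi> (Suc i) (y # ys[i := t]) * \<phi> (Suc i) (y' # ys[i := t]) =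
      \<phi> (Suc i) (y # ys) * \<phi> (Suc i) (y' # ys)" if "i < Suc k" "length ys = Suc k"
      using p(1)[of "Suc i" "y # ys" t] p(1)[of "Suc i" "y' # ys" t] that by simp
  qed
  define X where "X = (\<Sum>xs\<in>tuples P (Suc (Suc k)). parity (c \<inter> \<Inter> (set xs)) * h xs)"
  have "X = (\<Sum>ys\<in>L. \<Sum>y\<in>P. parity (c \<inter> \<Inter> (set (y # ys))) * h (y # ys))"
    unfolding X_def L_def by (rule sum_tuples_Suc)
  also have "\<dots> = (\<Sum>ys\<in>L. \<phi> 0 ({} # ys) * (\<Sum>y\<in>P. F y ys))"
    unfolding sum_distrib_left
    by (intro sum.cong) (auto simp: L_def in_tuples h F_def Int_assoc)
  finally have "X\<^sup>2 \<le> (\<Sum>ys\<in>L. (\<phi> 0 ({} # ys))\<^sup>2) * (\<Sum>ys\<in>L. (\<Sum>y\<in>P. F y ys)\<^sup>2)"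
    by (simp only: Cauchy_Schwarz_ineq_sum)
  also have "\<dots> \<le> (\<Sum>ys\<in>L. 1) * (\<Sum>ys\<in>L. (\<Sum>y\<in>P. F y ys)\<^sup>2)"
    using p(2) by (intro mult_right_mono sum_mono sum_nonneg) (auto simp: abs_square_le_1)
  also have "\<dots> = ?N ^ Suc k * (\<Sum>ys\<in>L. (\<Sum>y\<in>P. F y ys)\<^sup>2)"
    using cardL by simp
  also have "(\<Sum>ys\<in>L. (\<Sum>y\<in>P. F y ys)\<^sup>2) = (\<Sum>y\<in>P. \<Sum>y'\<in>P. \<Sum>ys\<in>L. F y ys * F y' ys)"
    unfolding power2_eq_square sum_product
    by (subst sum.swap, intro sum.cong refl, subst sum.swap) simp
  also have "\<dots> \<le> (\<Sum>y\<in>P. \<Sum>y'\<in>P. ?N ^ Suc k * \<rho> ^ card (c \<inter> sym_diff y y'))"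
  proof (intro sum_mono)
    fix y y' assume y: "y \<in> P" "y' \<in> P"
    have fin: "finite (c \<inter> y \<inter> Z)" "finite (c \<inter> y' \<inter> Z)" for Z
      using y S unfolding P_def by (meson PowD finite_Int finite_subset)+
    have "F y ys * F y' ys = parity (c \<inter> sym_diff y y' \<inter> \<Inter> (set ys)) * (g y ys * g y' ys)" for ys
    proof -
      have "sym_diff (c \<inter> y \<inter> \<Inter> (set ys)) (c \<inter> y' \<inter> \<Inter> (set ys)) = c \<inter> sym_diff y y' \<inter> \<Inter> (set ys)"
        by blast
      then have "parity (c \<inter> sym_diff y y' \<inter> \<Inter> (set ys)) =
          parity (c \<inter> y \<inter> \<Inter> (set ys)) * parity (c \<inter> y' \<inter> \<Inter> (set ys))"
        using parity_sym_diff[OF fin] by metis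
      then show ?thesis unfolding F_def by (simp add: mult_ac)
    qed
    then have "(\<Sum>ys\<in>L. F y ys * F y' ys) =
        (\<Sum>ys\<in>tuples (Pow S) (Suc k). parity (c \<inter> sym_diff y y' \<inter> \<Inter> (set ys)) * (g y ys * g y' ys))"
      unfolding L_def P_def by simp
    also have "\<dots> \<le> ?N ^ Suc k * \<rho> ^ card (c \<inter> sym_diff y y')"
      using Suc.IH[OF _ gg, of "c \<inter> sym_diff y y'" y y'] Suc.prems(1)
      unfolding \<rho>_def by (auto simp: abs_le_iff)
    finally show "(\<Sum>ys\<in>L. F y ys * F y' ys) \<le> ?N ^ Suc k * \<rho> ^ card (c \<inter> sym_diff y y')" .
  qed
  also have "\<dots> = (\<Sum>y\<in>P. ?N ^ Suc k * (?N * ((1 + \<rho>) / 2) ^ card c))"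
  proof (intro sum.cong refl)
    fix y assume y: "y \<in> P"
    have "bij_betw (sym_diff y) P P"
      using y unfolding P_def
      by (intro bij_betwI[where g = "sym_diff y"]) auto
    then have "(\<Sum>y'\<in>P. \<rho> ^ card (c \<inter> sym_diff y y')) = (\<Sum>z\<in>P. \<rho> ^ card (c \<inter> z))"
      by (rule sum.reindex_bij_betw)
    then show "(\<Sum>y'\<in>P. ?N ^ Suc k * \<rho> ^ card (c \<inter> sym_diff y y')) =
        ?N ^ Suc k * (?N * ((1 + \<rho>) / 2) ^ card c)"
      using sum_Pow_power_card[OF S Suc.prems(1), of \<rho>]
      by (simp add: P_def flip: sum_distrib_left)
  qed
  also have "\<dots> = ?N * (?N ^ Suc k * (?N * ((1 + \<rho>) / 2) ^ card c))"
    by (simp add: cardP)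
  also have "\<dots> \<le> ?N * (?N ^ Suc k * (?N * (\<rho>'\<^sup>2) ^ card c))"
  proof (intro mult_left_mono power_mono)
    \<comment> \<open>With \<open>x = (1/4) ^ Suc k\<close> this is
      \<open>1 - 2 * x <= (1 - x)^2\<close>: the square root taken after Cauchy--Schwarz costs a
      factor 2, and averaging over the new first block another 2, whence the base 1/4.\<close>
    have "(1 + \<rho>) / 2 = 1 - 2 * (1/4) ^ Suc k" by (simp add: \<rho>_def field_simps)
    also have "\<dots> \<le> \<rho>'\<^sup>2" unfolding \<rho>'_def by (simp add: power2_eq_square algebra_simps)
    finally show "(1 + \<rho>) / 2 \<le> \<rho>'\<^sup>2" .
    have "(1 / 4 :: real) ^ k \<le> 1" by (simp add: power_le_one)
    then show "0 \<le> (1 + \<rho>) / 2" by (simp add: \<rho>_def)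
  qed auto
  finally have "X\<^sup>2 \<le> ?N ^ Suc k * (?N * (?N ^ Suc k * (?N * (\<rho>'\<^sup>2) ^ card c)))"
    by simp
  also have "\<dots> = (?N ^ Suc (Suc k) * \<rho>' ^ card c)\<^sup>2"
    by (simp add: power2_eq_square power_mult_distrib mult_ac)
  finally have "X\<^sup>2 \<le> (?N ^ Suc (Suc k) * \<rho>' ^ card c)\<^sup>2" .
  moreover have "\<rho>' \<ge> 0" unfolding \<rho>'_def by (simp add: power_le_one del: power_Suc)
  ultimately have "\<bar>X\<bar> \<le> ?N ^ Suc (Suc k) * \<rho>' ^ card c"
    using abs_le_square_iff[of X "?N ^ Suc (Suc k) * \<rho>' ^ card c"] by simp
  then show ?case unfolding X_def P_def \<rho>'_def .
qed

subsection \<open>Correlation with polynomials of protocols\<close>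

lemma finite_bitvecs [simp]: "finite (bitvecs n)"
  using finite_lists_length_eq[of "UNIV :: bool set" n] by (simp add: bitvecs_def)

lemma card_bitvecs: "card (bitvecs n) = 2 ^ n"
  using card_lists_length_eq[of "UNIV :: bool set" n] by (simp add: bitvecs_def)

definition unblock :: "nat \<Rightarrow> nat \<Rightarrow> nat set list \<Rightarrow> bool list" where
  "unblock k m xs = map (\<lambda>p. p mod m \<in> xs ! (p div m)) [0..<k * m]"

lemma unblock_in_bitvecs: "unblock k m xs \<in> bitvecs (k * m)"
  by (simp add: unblock_def bitvecs_def)

lemma nth_unblock: "p < k * m \<Longrightarrow> unblock k m xs ! p \<longleftrightarrow> p mod m \<in> xs ! (p div m)"
  by (simp add: unblock_def)

lemma block_index_less:
  fixes i j k m :: nat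
  shows "i < k \<Longrightarrow> j < m \<Longrightarrow> i * m + j < k * m"
  by (metis add_strict_left_mono add.commute less_le_trans mult_Suc mult_le_mono1 Suc_leI)

lemma bij_betw_unblock:
  assumes "m > 0"
  shows "bij_betw (unblock k m) (tuples (Pow {..<m}) k) (bitvecs (k * m))"
proof (rule bij_betw_byWitness[where f' = "\<lambda>x. map (\<lambda>i. {j. j < m \<and> x ! (i * m + j)}) [0..<k]"])
  show "\<forall>xs\<in>tuples (Pow {..<m}) k. map (\<lambda>i. {j. j < m \<and> unblock k m xs ! (i * m + j)}) [0..<k] = xs"
  proof
    fix xs assume xs: "xs \<in> tuples (Pow {..<m}) k"
    show "map (\<lambda>i. {j. j < m \<and> unblock k m xs ! (i * m + j)}) [0..<k] = xs"
    proof (rule nth_equalityI)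
      fix i assume "i < length (map (\<lambda>i. {j. j < m \<and> unblock k m xs ! (i * m + j)}) [0..<k])"
      then have i: "i < k" by simp
      then have "xs ! i \<subseteq> {..<m}" using xs by (auto simp: in_tuples subset_iff dest!: nth_mem)
      moreover have "unblock k m xs ! (i * m + j) \<longleftrightarrow> j \<in> xs ! i" if "j < m" for j
        using nth_unblock[OF block_index_less[OF i that]] that by simp
      ultimately show "map (\<lambda>i. {j. j < m \<and> unblock k m xs ! (i * m + j)}) [0..<k] ! i = xs ! i"
        using i by auto
    qed (use xs in \<open>simp add: in_tuples\<close>)
  qed
  show "\<forall>x\<in>bitvecs (k * m). unblock k m (map (\<lambda>i. {j. j < m \<and> x ! (i * m + j)}) [0..<k]) = x"
  proof
    fix x assume x: "x \<in> bitvecs (k * m)"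
    show "unblock k m (map (\<lambda>i. {j. j < m \<and> x ! (i * m + j)}) [0..<k]) = x"
    proof (rule nth_equalityI)
      fix p assume "p < length (unblock k m (map (\<lambda>i. {j. j < m \<and> x ! (i * m + j)}) [0..<k]))"
      then have p: "p < k * m" by (simp add: unblock_def)
      then have "p div m < k" by (simp add: less_mult_imp_div_less)
      then show "unblock k m (map (\<lambda>i. {j. j < m \<and> x ! (i * m + j)}) [0..<k]) ! p = x ! p"
        using assms by (simp add: nth_unblock[OF p])
    qed (use x in \<open>simp add: unblock_def bitvecs_def\<close>)
  qed
  show "unblock k m ` tuples (Pow {..<m}) k \<subseteq> bitvecs (k * m)"
    using unblock_in_bitvecs by blast
  show "(\<lambda>x. map (\<lambda>i. {j. j < m \<and> x ! (i * m + j)}) [0..<k]) ` bitvecs (k * m) \<subseteq> tuples (Pow {..<m}) k"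
    by (auto simp: in_tuples)
qed

lemma sg_gip_unblock:
  assumes "m > 0" "k > 0" "length xs = k"
  shows "sg (gip k (k * m) (unblock k m xs)) = parity ({..<m} \<inter> \<Inter> (set xs))"
proof -
  have "(\<forall>i<k. unblock k m xs ! (i * m + j)) \<longleftrightarrow> j \<in> \<Inter> (set xs)" if "j < m" for j
    using nth_unblock[OF block_index_less[OF _ that]] that assms
    by (simp add: all_set_conv_all_nth)
  then have "{j. j < m \<and> (\<forall>i<k. unblock k m xs ! (i * m + j))} = {..<m} \<inter> \<Inter> (set xs)"
    by auto
  then show ?thesis using assms by (simp add: gip_def sg_def parity_def)
qed

section \<open>Correlation bounds for products of protocols\<close>

definition blind :: "nat \<Rightarrow> nat \<Rightarrow> nat \<Rightarrow> (bool list \<Rightarrow> bool) \<Rightarrow> bool" where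
  "blind k n i f \<longleftrightarrow> (\<forall>x\<in>bitvecs n. \<forall>y\<in>bitvecs n.
     (\<forall>j<n. j div (n div k) \<noteq> i \<longrightarrow> x ! j = y ! j) \<longrightarrow> f x = f y)"

lemma blind_unblock:
  assumes "k > 0" "blind k (k * m) i f"
  shows "f (unblock k m (xs[i := y])) = f (unblock k m xs)"
  using assms unblock_in_bitvecs unfolding blind_def by (simp add: nth_unblock)

text \<open>Quantifying over all cylinder functions \<open>h\<close> makes the bound stable under
  further factors that miss a block. Protocols can thus be multiplied in one at a time.\<close>

definition cyl_bounded where
  "cyl_bounded k X f g D \<longleftrightarrow>
     (\<forall>h. cylinder k h \<longrightarrow> \<bar>\<Sum>xs\<in>X. f xs * (h xs * g xs)\<bar> \<le> (D::real))"

lemma cylinder_one: "cylinder k (\<lambda>_. 1)"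
  unfolding cylinder_def by (intro exI[of _ "\<lambda>_ _. 1"]) simp

lemma cyl_bounded_nonneg: "cyl_bounded k X f g D \<Longrightarrow> D \<ge> 0"
  unfolding cyl_bounded_def using cylinder_one by (meson abs_ge_zero order.trans)

lemma cyl_bounded_mono: "cyl_bounded k X f g D \<Longrightarrow> D \<le> D' \<Longrightarrow> cyl_bounded k X f g D'"
  unfolding cyl_bounded_def by (meson order.trans)

lemma cyl_bounded_scale:
  assumes "cyl_bounded k X f g D"
  shows "cyl_bounded k X f (\<lambda>xs. c * g xs) (\<bar>c\<bar> * D)"
  unfolding cyl_bounded_def
proof (intro allI impI)
  fix h :: "'a list \<Rightarrow> real" assume "cylinder k h"
  then have "\<bar>\<Sum>xs\<in>X. f xs * (h xs * g xs)\<bar> \<le> D" using assms by (simp add: cyl_bounded_def)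
  moreover have "(\<Sum>xs\<in>X. f xs * (h xs * (c * g xs))) = c * (\<Sum>xs\<in>X. f xs * (h xs * g xs))"
    by (simp add: sum_distrib_left mult_ac)
  ultimately show "\<bar>\<Sum>xs\<in>X. f xs * (h xs * (c * g xs))\<bar> \<le> \<bar>c\<bar> * D"
    by (simp add: abs_mult mult_left_mono)
qed

lemma cyl_bounded_add:
  assumes "cyl_bounded k X f g D" "cyl_bounded k X f g' D'"
  shows "cyl_bounded k X f (\<lambda>xs. g xs + g' xs) (D + D')"
  unfolding cyl_bounded_def
proof (intro allI impI)
  fix h :: "'a list \<Rightarrow> real" assume "cylinder k h"
  then have "\<bar>\<Sum>xs\<in>X. f xs * (h xs * g xs)\<bar> \<le> D" "\<bar>\<Sum>xs\<in>X. f xs * (h xs * g' xs)\<bar> \<le> D'"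
    using assms by (simp_all add: cyl_bounded_def)
  then show "\<bar>\<Sum>xs\<in>X. f xs * (h xs * (g xs + g' xs))\<bar> \<le> D + D'"
    by (simp add: distrib_left sum.distrib abs_le_iff)
qed

lemma cyl_bounded_mult:
  assumes "cyl_bounded k X f g D" "i < k"
    and "\<And>xs y. length xs = k \<Longrightarrow> c (xs[i := y]) = c xs" "\<And>xs. \<bar>c xs\<bar> \<le> 1"
  shows "cyl_bounded k X f (\<lambda>xs. c xs * g xs) D"
  unfolding cyl_bounded_def
proof (intro allI impI)
  fix h :: "'a list \<Rightarrow> real" assume h: "cylinder k h"
  have "cylinder k (\<lambda>xs. c xs * h xs)" using h assms(2-4) by (rule cylinder_mult)
  then have "\<bar>\<Sum>xs\<in>X. f xs * (c xs * h xs * g xs)\<bar> \<le> D"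
    using assms(1) unfolding cyl_bounded_def by blast
  then show "\<bar>\<Sum>xs\<in>X. f xs * (h xs * (c xs * g xs))\<bar> \<le> D" by (simp add: mult_ac)
qed

text \<open>Split on the first bit written. The indicator of each outcome ignores the speaker's
  block and is absorbed by the cylinder function, so each bit of communication doubles the
  bound.\<close>

lemma cyl_bounded_nof:
  assumes "k > 0" "cyl_bounded k X f g D" "nof_valid k (k * m) p"
  shows "cyl_bounded k X f (\<lambda>xs. sg (nof_run p (unblock k m xs)) * g xs) (2 ^ nof_cost p * D)"
  using assms(3)
proof (induction p)
  case (Out b)
  then show ?case using cyl_bounded_scale[OF assms(2), of "sg b"] by simp
next
  case (Send i b p0 p1)
  let ?C = "max (nof_cost p0) (nof_cost p1)"
  have i: "i < k" and b: "blind k (k * m) i b"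
    and valid: "nof_valid k (k * m) p0" "nof_valid k (k * m) p1"
    using Send.prems unfolding nof_valid.simps blind_def by blast+
  have D: "D \<ge> 0" using assms(2) by (rule cyl_bounded_nonneg)
  have "cyl_bounded k X f (\<lambda>xs. sg (nof_run p0 (unblock k m xs)) * g xs) (2 ^ ?C * D)"
    "cyl_bounded k X f (\<lambda>xs. sg (nof_run p1 (unblock k m xs)) * g xs) (2 ^ ?C * D)"
    by (rule cyl_bounded_mono[OF Send.IH(1)[OF valid(1)]] cyl_bounded_mono[OF Send.IH(2)[OF valid(2)]],
        intro mult_right_mono power_increasing D; simp)+
  note IH = this
  have 1: "cyl_bounded k X f (\<lambda>xs. of_bool (b (unblock k m xs)) *
      (sg (nof_run p1 (unblock k m xs)) * g xs)) (2 ^ ?C * D)"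
    by (rule cyl_bounded_mult[OF IH(2) i]) (simp_all add: blind_unblock[OF assms(1) b])
  have 0: "cyl_bounded k X f (\<lambda>xs. of_bool (\<not> b (unblock k m xs)) *
      (sg (nof_run p0 (unblock k m xs)) * g xs)) (2 ^ ?C * D)"
    by (rule cyl_bounded_mult[OF IH(1) i]) (simp_all add: blind_unblock[OF assms(1) b])
  have "(\<lambda>xs. sg (nof_run (Send i b p0 p1) (unblock k m xs)) * g xs) =
    (\<lambda>xs. of_bool (b (unblock k m xs)) * (sg (nof_run p1 (unblock k m xs)) * g xs) +
      of_bool (\<not> b (unblock k m xs)) * (sg (nof_run p0 (unblock k m xs)) * g xs))"
    by (auto simp: fun_eq_iff)
  moreover have "2 ^ nof_cost (Send i b p0 p1) * D = 2 ^ ?C * D + 2 ^ ?C * D" by simp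
  ultimately show ?case using cyl_bounded_add[OF 1 0] by (simp only:)
qed

text \<open>Each sign in a monomial is moved into \<open>g\<close> at the price of a factor
  \<open>2 ^ R\<close>, which is why \<open>g\<close> and \<open>D\<close> vary in the
  induction.\<close>

lemma cyl_bounded_sign_poly:
  assumes "k > 0" and "sign_poly V d M h" and "cyl_bounded k X f g D"
    and P: "\<And>i. i \<in> V \<Longrightarrow> nof_valid k (k * m) (P i)" "\<And>i. i \<in> V \<Longrightarrow> nof_cost (P i) \<le> R"
  shows "cyl_bounded k X f (\<lambda>xs. h (\<lambda>i. nof_run (P i) (unblock k m xs)) * g xs) (M * 2 ^ (d * R) * D)"
  using assms(2,3)
proof (induction arbitrary: g D rule: sign_poly.induct)
  case (const c M d)
  have D: "D \<ge> 0" using const by (intro cyl_bounded_nonneg)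
  have "\<bar>c\<bar> * 1 * D \<le> M * 2 ^ (d * R) * D"
    using const D by (intro mult_right_mono mult_mono) auto
  then show ?case using cyl_bounded_mono[OF cyl_bounded_scale[OF const(2), of c]] by simp
next
  case (sign i d M h)
  have D: "D \<ge> 0" using sign by (intro cyl_bounded_nonneg)
  have "cyl_bounded k X f (\<lambda>xs. sg (nof_run (P i) (unblock k m xs)) * g xs) (2 ^ R * D)"
    using P sign D
    by (intro cyl_bounded_mono[OF cyl_bounded_nof[OF assms(1) sign.prems]] mult_right_mono power_increasing) auto
  from sign.IH[OF this] show ?case by (simp add: mult_ac power_add)
next
  case (add d M1 h1 M2 h2)
  then show ?case using cyl_bounded_add[OF add.IH(1)[OF add.prems] add.IH(2)[OF add.prems]]
    by (simp add: algebra_simps)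
qed

lemma gip_sign_poly_correlation:
  assumes "k > 0" "m > 0" and h: "sign_poly V d M h"
    and P: "\<And>i. i \<in> V \<Longrightarrow> nof_valid k (k * m) (P i)" "\<And>i. i \<in> V \<Longrightarrow> nof_cost (P i) \<le> R"
  shows "\<bar>\<Sum>x\<in>bitvecs (k * m). sg (gip k (k * m) x) * h (\<lambda>i. nof_run (P i) x)\<bar>
    \<le> M * 2 ^ (d * R) * (2 ^ (k * m) * (1 - (1/4) ^ (k - 1)) ^ m)"
proof -
  let ?X = "tuples (Pow {..<m}) k" and ?f = "\<lambda>xs. parity ({..<m} \<inter> \<Inter> (set xs))"
  let ?D = "2 ^ (k * m) * (1 - (1/4) ^ (k - 1)) ^ m :: real"
  have "cyl_bounded k ?X ?f (\<lambda>_. 1) ?D"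
    unfolding cyl_bounded_def
    using parity_correlation[of "{..<m}" "{..<m}" "k - 1"] assms(1)
    by (simp add: power_mult mult.commute[of k m])
  from cyl_bounded_sign_poly[OF assms(1) h this P, simplified]
  have "cyl_bounded k ?X ?f (\<lambda>xs. h (\<lambda>i. nof_run (P i) (unblock k m xs))) (M * 2 ^ (d * R) * ?D)"
    by simp
  then have "\<bar>\<Sum>xs\<in>?X. ?f xs * (1 * h (\<lambda>i. nof_run (P i) (unblock k m xs)))\<bar> \<le> M * 2 ^ (d * R) * ?D"
    unfolding cyl_bounded_def using cylinder_one by blast
  also have "(\<Sum>xs\<in>?X. ?f xs * (1 * h (\<lambda>i. nof_run (P i) (unblock k m xs)))) =
     (\<Sum>xs\<in>?X. sg (gip k (k * m) (unblock k m xs)) * h (\<lambda>i. nof_run (P i) (unblock k m xs)))"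
    using assms by (intro sum.cong) (auto simp: sg_gip_unblock in_tuples)
  also have "\<dots> = (\<Sum>x\<in>bitvecs (k * m). sg (gip k (k * m) x) * h (\<lambda>i. nof_run (P i) x))"
    using bij_betw_unblock[OF assms(2)] by (rule sum.reindex_bij_betw)
  finally show ?thesis .
qed

subsection \<open>Randomized protocols\<close>

lemma feval_cong: "(\<And>i. i \<in> fvars F \<Longrightarrow> a i = b i) \<Longrightarrow> feval F a = feval F b"
  by (induction F) auto

section \<open>The trivial protocol and derandomization\<close>

lemma nof_valid_Send:
  "nof_valid k n (Send i f p0 p1) \<longleftrightarrow> i < k \<and> blind k n i f \<and> nof_valid k n p0 \<and> nof_valid k n p1"
  by (simp add: blind_def)

text \<open>Player 1 writes block 0 bit by bit, \<open>bs\<close> being the part already announced.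
  Player 0 sees all other blocks, hence then knows the whole input and writes the answer.\<close>

lemma nof_protocol_prefix:
  assumes k: "k \<ge> 2" and m: "m > 0" and "length bs + r = m"
  shows "\<exists>p. nof_valid k (k * m) p \<and> nof_cost p \<le> r + 1 \<and>
    (\<forall>x\<in>bitvecs (k * m). take (length bs) x = bs \<longrightarrow> nof_run p x = g x)"
  using assms(3)
proof (induction r arbitrary: bs)
  case 0
  let ?f = "\<lambda>x. g (bs @ drop m x)"
  have "blind k (k * m) 0 ?f"
    unfolding blind_def
  proof (intro ballI impI)
    fix x y assume xy: "x \<in> bitvecs (k * m)" "y \<in> bitvecs (k * m)"
      "\<forall>j<k * m. j div (k * m div k) \<noteq> 0 \<longrightarrow> x ! j = y ! j"
    have "drop m x = drop m y"
    proof (rule nth_equalityI)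
      fix j assume "j < length (drop m x)"
      then have j: "m + j < k * m" using xy by (simp add: bitvecs_def)
      then have "x ! (m + j) = y ! (m + j)" using xy(3) k m by (simp add: div_eq_0_iff)
      moreover have "m \<le> k * m" using k by simp
      ultimately show "drop m x ! j = drop m y ! j" using xy(1,2) by (simp add: bitvecs_def)
    qed (use xy in \<open>simp add: bitvecs_def\<close>)
    then show "?f x = ?f y" by simp
  qed
  moreover have "g (bs @ drop m x) = g x" if "take (length bs) x = bs" for x
    using 0 that by (metis add.right_neutral append_take_drop_id)
  ultimately show ?case
    using k by (intro exI[of _ "Send 0 ?f (Out False) (Out True)"])
      (auto simp: nof_valid_Send simp del: nof_valid.simps(2))
next
  case (Suc r)
  have "\<exists>p. nof_valid k (k * m) p \<and> nof_cost p \<le> r + 1 \<and>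
    (\<forall>x\<in>bitvecs (k * m). take (length (bs @ [b])) x = bs @ [b] \<longrightarrow> nof_run p x = g x)" for b
    using Suc.prems by (intro Suc.IH) simp
  then obtain P where P: "\<And>b. nof_valid k (k * m) (P b)" "\<And>b. nof_cost (P b) \<le> r + 1"
    "\<And>b x. x \<in> bitvecs (k * m) \<Longrightarrow> take (length (bs @ [b])) x = bs @ [b] \<Longrightarrow> nof_run (P b) x = g x"
    by metis
  let ?f = "\<lambda>x. x ! length bs"
  have l: "length bs < m" using Suc.prems by simp
  also have "m \<le> k * m" using k by simp
  finally have lk: "length bs < k * m" .
  have "blind k (k * m) 1 ?f"
    unfolding blind_def using l lk k by auto
  moreover have "nof_run (Send 1 ?f (P False) (P True)) x = g x"
    if "x \<in> bitvecs (k * m)" "take (length bs) x = bs" for x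
  proof -
    have "nof_run (P (?f x)) x = g x"
      using that lk by (intro P(3)) (auto simp: bitvecs_def take_Suc_conv_app_nth)
    then show ?thesis by (cases "?f x") simp_all
  qed
  ultimately show ?case
    using k P(1,2) by (intro exI[of _ "Send 1 ?f (P False) (P True)"])
      (auto simp: nof_valid_Send simp del: nof_valid.simps(2) nof_run.simps(2))
qed

lemma rand_nof_computes_trivial:
  assumes "k \<ge> 2" "m > 0" "\<delta> \<ge> 0"
  shows "rand_nof_computes k (k * m) \<delta> g (m + 1)"
proof -
  obtain p where "nof_valid k (k * m) p" "nof_cost p \<le> m + 1" "\<forall>x\<in>bitvecs (k * m). nof_run p x = g x"
    using nof_protocol_prefix[OF assms(1,2), of "[]" m g] by auto
  then show ?thesis
    unfolding rand_nof_computes_def using assms(3) by (intro exI[of _ "return_pmf p"]) auto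
qed

text \<open>The trivial protocol shows that the minimum in \<open>R_nof\<close> is attained and
  bounds the costs uniformly over \<open>G\<close>, so \<open>LEAST\<close> and \<open>Sup\<close>
  have their intended meaning.\<close>

lemma R_nof_le_class:
  assumes "k \<ge> 2" "m > 0" "\<delta> \<ge> 0" "g \<in> G"
  shows "rand_nof_computes k (k * m) \<delta> g (R_nof k (k * m) \<delta> g)"
    and "R_nof k (k * m) \<delta> g \<le> R_nof_class k (k * m) \<delta> G"
proof -
  note triv = rand_nof_computes_trivial[OF assms(1-3)]
  show "rand_nof_computes k (k * m) \<delta> g (R_nof k (k * m) \<delta> g)"
    unfolding R_nof_def using triv by (rule LeastI)
  have "R_nof k (k * m) \<delta> g' \<le> m + 1" for g'
    unfolding R_nof_def using triv by (rule Least_le)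
  then have "bdd_above ((\<lambda>g. R_nof k (k * m) \<delta> g) ` G)" by (intro bdd_aboveI2)
  then show "R_nof k (k * m) \<delta> g \<le> R_nof_class k (k * m) \<delta> G"
    unfolding R_nof_class_def using assms(4) by (intro cSUP_upper)
qed

text \<open>The expected number of wrong inputs is at most \<open>\<delta> * 2 ^ n\<close>, so some
  protocol in the support does no worse.\<close>

lemma derandomize:
  assumes "rand_nof_computes k n \<delta> g c"
  shows "\<exists>p. nof_valid k n p \<and> nof_cost p \<le> c \<and>
    real (card {x\<in>bitvecs n. nof_run p x \<noteq> g x}) \<le> \<delta> * 2 ^ n"
proof -
  obtain P where P: "\<forall>p\<in>set_pmf P. nof_valid k n p \<and> nof_cost p \<le> c"
    "\<forall>x\<in>bitvecs n. measure_pmf.prob P {p. nof_run p x = g x} \<ge> 1 - \<delta>"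
    using assms unfolding rand_nof_computes_def by blast
  define X where "X p = real (card {x\<in>bitvecs n. nof_run p x \<noteq> g x})" for p
  have X: "X p = (\<Sum>x\<in>bitvecs n. indicator {p. nof_run p x \<noteq> g x} p)" for p
    by (simp add: X_def indicator_def sum.If_cases Int_def of_bool_def)
  have int: "integrable (measure_pmf P) X"
    unfolding X by (intro Bochner_Integration.integrable_sum) (auto intro: measure_pmf.integrable_const_bound[where B = 1] simp: indicator_def)
  have "measure_pmf.expectation P X = (\<Sum>x\<in>bitvecs n. measure_pmf.prob P {p. nof_run p x \<noteq> g x})"
    unfolding X by (subst Bochner_Integration.integral_sum)
      (auto intro: measure_pmf.integrable_const_bound[where B = 1] simp: indicator_def)
  also have "\<dots> \<le> (\<Sum>x\<in>bitvecs n. \<delta>)"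
  proof (intro sum_mono)
    fix x assume "x \<in> bitvecs n"
    have "measure_pmf.prob P {p. nof_run p x \<noteq> g x} = 1 - measure_pmf.prob P {p. nof_run p x = g x}"
      using measure_pmf.prob_compl[of "{p. nof_run p x = g x}" P]
      by (simp add: set_diff_eq)
    then show "measure_pmf.prob P {p. nof_run p x \<noteq> g x} \<le> \<delta>"
      using P(2) \<open>x \<in> bitvecs n\<close> by force
  qed
  also have "\<dots> = \<delta> * 2 ^ n" by (simp add: card_bitvecs)
  finally have le: "measure_pmf.expectation P X \<le> \<delta> * 2 ^ n" .
  have "\<exists>p\<in>set_pmf P. X p \<le> \<delta> * 2 ^ n"
  proof (rule ccontr)
    assume "\<not> ?thesis"
    then have "AE p in measure_pmf P. \<delta> * 2 ^ n < X p" by (auto simp: AE_measure_pmf_iff)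
    then have "\<delta> * 2 ^ n < measure_pmf.expectation P X"
      by (intro measure_pmf.expectation_greater int)
    with le show False by simp
  qed
  then show ?thesis using P(1) unfolding X_def by blast
qed

section \<open>Comparing the advantage with the correlation bound\<close>

lemma agreement_sum:
  fixes f g :: "'a \<Rightarrow> bool"
  assumes "finite X"
  shows "(\<Sum>x\<in>X. sg (f x) * sg (g x)) = 2 * real (card {x\<in>X. g x = f x}) - real (card X)"
proof -
  have "(\<Sum>x\<in>X. sg (f x) * sg (g x)) = (\<Sum>x\<in>X. 2 * of_bool (g x = f x) - 1)"
    by (intro sum.cong) (auto simp: sg_def)
  also have "\<dots> = 2 * real (card {x\<in>X. g x = f x}) - real (card X)"
    using assms by (simp add: sum_subtractf flip: sum_distrib_left) (simp add: of_bool_def sum.If_cases Int_def)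
  finally show ?thesis .
qed

text \<open>Fixing the coins costs \<open>\<epsilon> / 2\<close> of the advantage, leaving
  correlation at least \<open>\<epsilon>\<close> between the formula and the inner product.
  Replacing the formula by its polynomial costs \<open>\<epsilon> / 2\<close> per input, so the
  polynomial keeps correlation \<open>\<epsilon> / 2\<close>.\<close>

lemma correlation_upper_bound:
  fixes n s :: nat and \<epsilon> :: real
  assumes k: "k \<ge> 2" and m: "m > 0" and n: "n = k * m" and s: "s > 0" "real s \<le> real n ^ 2"
    and \<epsilon>: "0 < \<epsilon>" and C: "formula_comp_class n s G C"
    and adv: "real (card {x\<in>bitvecs n. C x = gip k n x}) / 2 ^ n \<ge> 1/2 + \<epsilon>"
    and T: "real T \<ge> 400 * sqrt s" and l: "(1/2) ^ l \<le> \<epsilon> / 4"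
  shows "\<epsilon> / 2 \<le> (1 + 2 * (1 + 2 * real (2 * s + 1) ^ T) ^ (2 * l)) *
      2 ^ (2 * l * T * R_nof_class k n (\<epsilon> / (2 * real n ^ 2)) G) * (1 - (1/4) ^ (k - 1)) ^ m"
proof -
  define \<delta> where "\<delta> = \<epsilon> / (2 * real n ^ 2)"
  define R where "R = R_nof_class k n \<delta> G"
  have n0: "n > 0" using n k m by simp
  have \<delta>: "\<delta> \<ge> 0" using \<epsilon> by (simp add: \<delta>_def)
  obtain F g where F: "fsize F \<le> s" "fvars F \<subseteq> {..<s}" and g: "\<forall>i<s. g i \<in> G"
    and Cx: "\<forall>x\<in>bitvecs n. C x = feval F (\<lambda>i. g i x)"
    using C unfolding formula_comp_class_def by blast
  have "\<exists>p. i < s \<longrightarrow> nof_valid k n p \<and> nof_cost p \<le> R \<and>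
    real (card {x\<in>bitvecs n. nof_run p x \<noteq> g i x}) \<le> \<delta> * 2 ^ n" for i
  proof (cases "i < s")
    case True
    then have "g i \<in> G" using g by blast
    note R_nof_le_class[OF k m \<delta> this, folded n]
    with derandomize show ?thesis unfolding R_def by (meson order.trans)
  qed simp
  then obtain P where P: "\<And>i. i < s \<Longrightarrow> nof_valid k n (P i)" "\<And>i. i < s \<Longrightarrow> nof_cost (P i) \<le> R"
    "\<And>i. i < s \<Longrightarrow> real (card {x\<in>bitvecs n. nof_run (P i) x \<noteq> g i x}) \<le> \<delta> * 2 ^ n"
    by metis
  define a where "a x i = nof_run (P i) x" for x i
  \<comment> \<open>The inputs on which some protocol errs. By the union bound and
    \<open>s <= n^2\<close> their fraction is at most
    \<open>s * \<delta> <= \<epsilon> / 2\<close>.\<close>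
  define B where "B = (\<Union>i<s. {x\<in>bitvecs n. nof_run (P i) x \<noteq> g i x})"
  have "real (card B) \<le> (\<Sum>i<s. real (card {x\<in>bitvecs n. nof_run (P i) x \<noteq> g i x}))"
    unfolding B_def by (simp flip: of_nat_sum add: card_UN_le)
  also have "\<dots> \<le> (\<Sum>i<s. \<delta> * 2 ^ n)" using P(3) by (intro sum_mono) auto
  also have "\<dots> = real s * \<delta> * 2 ^ n" by simp
  also have "\<dots> \<le> real n ^ 2 * \<delta> * 2 ^ n" using s \<delta> by (intro mult_right_mono) auto
  also have "\<dots> = \<epsilon> / 2 * 2 ^ n" using n0 by (simp add: \<delta>_def)
  finally have B: "real (card B) \<le> \<epsilon> / 2 * 2 ^ n" .
  have finB: "finite B" unfolding B_def by (auto intro: finite_subset[OF _ finite_bitvecs])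
  have "{x\<in>bitvecs n. C x = gip k n x} \<subseteq> {x\<in>bitvecs n. feval F (a x) = gip k n x} \<union> B"
  proof
    fix x assume x: "x \<in> {x\<in>bitvecs n. C x = gip k n x}"
    show "x \<in> {x\<in>bitvecs n. feval F (a x) = gip k n x} \<union> B"
    proof (cases "x \<in> B")
      case False
      then have "feval F (a x) = feval F (\<lambda>i. g i x)"
        using x F(2) by (intro feval_cong) (auto simp: B_def a_def)
      then show ?thesis using x Cx by auto
    qed simp
  qed
  then have "card {x\<in>bitvecs n. C x = gip k n x} \<le> card ({x\<in>bitvecs n. feval F (a x) = gip k n x} \<union> B)"
    using finB by (intro card_mono) auto
  also have "\<dots> \<le> card {x\<in>bitvecs n. feval F (a x) = gip k n x} + card B" by (rule card_Un_le)
  finally have "real (card {x\<in>bitvecs n. C x = gip k n x}) \<le>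
      real (card {x\<in>bitvecs n. feval F (a x) = gip k n x}) + real (card B)" by linarith
  moreover have "(1/2 + \<epsilon>) * 2 ^ n \<le> real (card {x\<in>bitvecs n. C x = gip k n x})"
    using adv by (simp add: field_simps)
  ultimately have agree: "(1/2 + \<epsilon> / 2) * 2 ^ n \<le> real (card {x\<in>bitvecs n. feval F (a x) = gip k n x})"
    using B by (simp add: algebra_simps)
  have T': "real T \<ge> 400 * sqrt (fsize F)"
    using T F(1) by (smt (verit) of_nat_mono real_sqrt_le_mono mult_left_mono)
  have finA: "finite (a ` bitvecs n)" by simp
  obtain q where q: "sign_poly (fvars F) (2 * l * T) (1 + 2 * (1 + 2 * real (2 * fsize F + 1) ^ T) ^ (2 * l)) q"
    and err: "\<And>x. x \<in> bitvecs n \<Longrightarrow> \<bar>q (a x) - sg (feval F (a x))\<bar> \<le> 2 * (1/2) ^ l"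
    using formula_sign_approx[OF finA T', of l] by blast
  let ?M = "1 + 2 * (1 + 2 * real (2 * s + 1) ^ T) ^ (2 * l)"
  have q: "sign_poly {..<s} (2 * l * T) ?M q"
  proof (rule sign_poly_weaken[OF sign_poly_mono_vars[OF q F(2)] order.refl])
    show "1 + 2 * (1 + 2 * real (2 * fsize F + 1) ^ T) ^ (2 * l) \<le> ?M"
      using F(1) by (intro add_left_mono mult_left_mono power_mono) auto
  qed
  have up: "\<bar>\<Sum>x\<in>bitvecs n. sg (gip k n x) * q (a x)\<bar> \<le>
      ?M * 2 ^ (2 * l * T * R) * (2 ^ n * (1 - (1/4) ^ (k - 1)) ^ m)"
    using gip_sign_poly_correlation[OF _ m q, of k P R] k P(1,2) unfolding n a_def by simp
  have "(\<Sum>x\<in>bitvecs n. sg (gip k n x) * sg (feval F (a x))) =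
      2 * real (card {x\<in>bitvecs n. feval F (a x) = gip k n x}) - 2 ^ n"
    by (simp add: agreement_sum card_bitvecs)
  then have "\<epsilon> * 2 ^ n \<le> (\<Sum>x\<in>bitvecs n. sg (gip k n x) * sg (feval F (a x)))"
    using agree by (simp add: algebra_simps)
  also have "\<dots> \<le> (\<Sum>x\<in>bitvecs n. sg (gip k n x) * q (a x) + \<epsilon> / 2)"
  proof (intro sum_mono)
    fix x assume "x \<in> bitvecs n"
    then have "\<bar>q (a x) - sg (feval F (a x))\<bar> \<le> \<epsilon> / 2" using err l by force
    then have "q (a x) - sg (feval F (a x)) \<le> \<epsilon> / 2" "sg (feval F (a x)) - q (a x) \<le> \<epsilon> / 2"
      by linarith+
    then show "sg (gip k n x) * sg (feval F (a x)) \<le> sg (gip k n x) * q (a x) + \<epsilon> / 2"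
      by (cases "gip k n x") (simp_all add: sg_def[of "gip k n x"] sg_def[of True] sg_def[of False])
  qed
  also have "\<dots> = (\<Sum>x\<in>bitvecs n. sg (gip k n x) * q (a x)) + \<epsilon> / 2 * 2 ^ n"
    by (simp add: sum.distrib card_bitvecs)
  finally have "\<epsilon> / 2 * 2 ^ n \<le> (\<Sum>x\<in>bitvecs n. sg (gip k n x) * q (a x))"
    by (simp add: algebra_simps)
  also have "\<dots> \<le> (?M * 2 ^ (2 * l * T * R) * (1 - (1/4) ^ (k - 1)) ^ m) * 2 ^ n"
    using up by (simp add: abs_le_iff mult_ac)
  finally show ?thesis unfolding R_def \<delta>_def by simp
qed

section \<open>Solving for the number of leaves\<close>

text \<open>Since \<open>N >= 3\<close>, the map \<open>t \<mapsto> 1 + 2 * t\<close> on powers of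
  \<open>N\<close> costs only one more factor \<open>N\<close>; it is absorbed twice.\<close>

lemma coefficient_bound:
  assumes N: "N \<ge> (3::real)" and "T \<ge> 1" "l \<ge> 1"
  shows "1 + 2 * (1 + 2 * N ^ T) ^ (2 * l) \<le> N ^ (6 * l * T)"
proof -
  have absorb: "1 + 2 * N ^ j \<le> N ^ (j + 1)" for j
  proof -
    have "1 \<le> N ^ j" using N by simp
    then have "1 + 2 * N ^ j \<le> 3 * N ^ j" by simp
    also have "\<dots> \<le> N * N ^ j" using N by (intro mult_right_mono) auto
    finally show ?thesis by simp
  qed
  have "(1 + 2 * N ^ T) ^ (2 * l) \<le> (N ^ (T + 1)) ^ (2 * l)"
    using absorb[of T] N by (intro power_mono) auto
  also have "\<dots> = N ^ ((T + 1) * (2 * l))" by (simp only: power_mult)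
  finally have "1 + 2 * (1 + 2 * N ^ T) ^ (2 * l) \<le> 1 + 2 * N ^ ((T + 1) * (2 * l))" by simp
  also have "\<dots> \<le> N ^ ((T + 1) * (2 * l) + 1)" by (rule absorb)
  also have "\<dots> \<le> N ^ (6 * l * T)"
  proof (intro power_increasing)
    obtain t u where "T = Suc t" "l = Suc u" using assms(2,3) by (metis Suc_le_D One_nat_def)
    then show "(T + 1) * (2 * l) + 1 \<le> 6 * l * T" by (simp add: algebra_simps)
  qed (use N in auto)
  finally show ?thesis .
qed

text \<open>Take logarithms. The decay contributes at least \<open>m * y\<close> because
  \<open>ln (1 - y) <= - y\<close>. The communication contributes \<open>d * R\<close>, and the
  coefficients contribute order \<open>d * log n\<close> because \<open>s < n^2\<close>, with
  \<open>d\<close> of order \<open>L * sqrt s\<close>.\<close>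

lemma size_from_correlation:
  fixes \<epsilon> L :: real and n s k m l T R :: nat
  assumes k: "k \<ge> 2" and m: "m > 0" and n: "n = k * m" and s: "s > 0" "s < n ^ 2"
    and \<epsilon>: "0 < \<epsilon>" "\<epsilon> < 1/2" and L: "L = log 2 (1 / \<epsilon>)"
    and T: "T = nat \<lceil>400 * sqrt s\<rceil>" and l: "l = nat \<lceil>L\<rceil> + 2"
    and bound: "\<epsilon> / 2 \<le> (1 + 2 * (1 + 2 * real (2 * s + 1) ^ T) ^ (2 * l)) *
      2 ^ (2 * l * T * R) * (1 - (1/4) ^ (k - 1)) ^ m"
  shows "real m / 4 ^ k \<le> 8020 * (L * sqrt s * (real R + log 2 n))"
proof -
  define y :: real where "y = (1/4) ^ (k - 1)"
  define d where "d = 2 * l * T"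
  define lg where "lg = log 2 (real n)"
  have n2: "n \<ge> 2" using n k m by (metis Suc_leI mult_le_mono One_nat_def mult.right_neutral)
  have lg: "lg \<ge> 1" using n2 by (simp add: lg_def le_log_iff)
  have L1: "L \<ge> 1"
  proof -
    have "2 \<le> 1 / \<epsilon>" using \<epsilon> by (simp add: field_simps)
    then show ?thesis unfolding L using \<epsilon> by (simp add: le_log_iff)
  qed
  have s1: "sqrt s \<ge> 1" using s by simp
  have T400: "real T \<ge> 400 * sqrt s" unfolding T by linarith
  have T1: "T \<ge> 1" using T400 s1 by linarith
  have Tle: "real T \<le> 401 * sqrt s" unfolding T using s1 by linarith
  have lle: "real l \<le> 4 * L" unfolding l using L1 by linarith
  have lL: "L + 1 \<le> real l" unfolding l by linarith
  have "y \<le> (1/4) ^ 1" unfolding y_def using k by (intro power_decreasing) auto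
  then have y: "0 < y" "y < 1" by (auto simp: y_def)
  have "1 + 2 * (1 + 2 * real (2 * s + 1) ^ T) ^ (2 * l) \<le> real (2 * s + 1) ^ (6 * l * T)"
    using s T1 l by (intro coefficient_bound) auto
  also have "\<dots> \<le> (real n ^ 3) ^ (6 * l * T)"
  proof (intro power_mono)
    have "2 * s + 1 \<le> 2 * n ^ 2" using s by simp
    also have "\<dots> \<le> n * n ^ 2" using n2 by (intro mult_right_mono) auto
    finally have "2 * s + 1 \<le> n ^ 3" by (simp add: power3_eq_cube power2_eq_square)
    then show "real (2 * s + 1) \<le> real n ^ 3" by (metis of_nat_le_iff of_nat_power)
  qed simp
  \<comment> \<open>The exponent is \<open>3 * 6 * l * T = 9 * d\<close>.\<close>
  also have "\<dots> = real n ^ (9 * d)" by (simp add: d_def mult.assoc flip: power_mult)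
  finally have M: "1 + 2 * (1 + 2 * real (2 * s + 1) ^ T) ^ (2 * l) \<le> real n ^ (9 * d)" .
  have "\<epsilon> / 2 \<le> real n ^ (9 * d) * 2 ^ (d * R) * (1 - y) ^ m"
    using bound M y unfolding d_def y_def[symmetric]
    by (elim order.trans) (intro mult_right_mono, auto)
  then have "ln (\<epsilon> / 2) \<le> ln (real n ^ (9 * d) * 2 ^ (d * R) * (1 - y) ^ m)"
    using \<epsilon> y n2 by (subst ln_le_cancel_iff) auto
  also have "\<dots> = 9 * d * ln n + d * R * ln 2 + m * ln (1 - y)"
    using y n2 by (simp add: ln_mult ln_realpow)
  also have "\<dots> \<le> 9 * d * ln n + d * R * ln 2 - m * y"
    using mult_left_mono[OF ln_le_minus_one[of "1 - y"], of "real m"] y by simp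
  finally have "m * y \<le> 9 * d * ln n + d * R * ln 2 - ln (\<epsilon> / 2)" by simp
  also have "ln (\<epsilon> / 2) = - (L + 1) * ln 2"
    using \<epsilon> by (simp add: L log_def ln_div algebra_simps)
  also have "ln (real n) = lg * ln 2" by (simp add: lg_def log_def)
  also have "9 * d * (lg * ln 2) + d * R * ln 2 - - (L + 1) * ln 2 = (9 * d * lg + d * R + (L + 1)) * ln 2"
    by (simp add: algebra_simps)
  also have "\<dots> \<le> (9 * d * lg + d * R + (L + 1)) * 1"
    using ln_2_less_1 L1 lg by (intro mult_left_mono) auto
  also have "\<dots> \<le> 9 * d * lg + d * R + d * lg"
  proof -
    have "L + 1 \<le> real l * 1" using lL by simp
    also have "\<dots> \<le> real l * real (2 * T)" using T1 by (intro mult_left_mono) auto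
    also have "\<dots> = real d * 1" by (simp add: d_def)
    also have "\<dots> \<le> real d * lg" using lg by (intro mult_left_mono) auto
    finally show ?thesis by (simp add: mult.commute)
  qed
  also have "\<dots> \<le> 10 * d * (R + lg)" by (simp add: algebra_simps)
  \<comment> \<open>Here 3208 = 2 * 4 * 401, from \<open>d = 2 * l * T\<close> and the bounds on
    \<open>l\<close> and \<open>T\<close>. Since \<open>y = 4 / 4 ^ k\<close>, the factor 32080
    becomes 8020 in the end.\<close>
  also have "\<dots> \<le> 10 * (3208 * (L * sqrt s)) * (R + lg)"
  proof -
    have "real d = 2 * (real l * real T)" by (simp add: d_def)
    also have "\<dots> \<le> 2 * (4 * L * (401 * sqrt s))"
      using lle Tle L1 by (intro mult_left_mono mult_mono) auto
    finally show ?thesis using lg by (intro mult_right_mono) auto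
  qed
  finally have "m * y \<le> 32080 * (L * sqrt s * (R + lg))" by simp
  moreover have "y = 4 / 4 ^ k"
    using k by (cases k) (auto simp: y_def power_divide)
  ultimately show ?thesis unfolding lg_def by (simp add: field_simps)
qed

theorem theorem3p1:
  shows "\<exists>c::real. c > 0 \<and>
    (\<forall>(k::nat) (n::nat) (s::nat) (\<epsilon>::real) (G :: (bool list \<Rightarrow> bool) set) (C :: bool list \<Rightarrow> bool).
       k \<ge> 2 \<longrightarrow> k dvd n \<longrightarrow> s > 0 \<longrightarrow> 0 < \<epsilon> \<longrightarrow> \<epsilon> < 1/2 \<longrightarrow>
       formula_comp_class n s G C \<longrightarrow>
       real (card {x\<in>bitvecs n. C x = gip k n x}) / 2 ^ n \<ge> 1/2 + \<epsilon> \<longrightarrow>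
       real s \<ge> c * real n ^ 2 /
         (real k ^ 2 * 16 ^ k *
          (real (R_nof_class k n (\<epsilon> / (2 * real n ^ 2)) G) + log 2 (real n)) ^ 2 *
          (log 2 (1 / \<epsilon>)) ^ 2))"
proof (intro exI[of _ "1 / 8020\<^sup>2"] conjI allI impI)
  fix k n s :: nat and \<epsilon> :: real and G C
  assume k: "k \<ge> 2" and kn: "k dvd n" and s: "s > 0" and \<epsilon>: "0 < \<epsilon>" "\<epsilon> < 1/2"
    and C: "formula_comp_class n s G C"
    and adv: "real (card {x\<in>bitvecs n. C x = gip k n x}) / 2 ^ n \<ge> 1/2 + \<epsilon>"
  define R where "R = R_nof_class k n (\<epsilon> / (2 * real n ^ 2)) G"
  define L where "L = log 2 (1 / \<epsilon>)"
  define S where "S = real R + log 2 (real n)"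
  obtain m where n: "n = k * m" using kn by (elim dvdE)
  have "1 / 8020\<^sup>2 * real n ^ 2 / (real k ^ 2 * 16 ^ k * S ^ 2 * L ^ 2) \<le> real s"
  proof (cases "m = 0")
    case True
    then show ?thesis by (simp add: n)
  next
    case False
    then have m: "m > 0" by simp
    have n2: "n \<ge> 2" using n k m by (metis Suc_leI mult_le_mono One_nat_def mult.right_neutral)
    have S1: "S \<ge> 1" using n2 by (simp add: S_def add_increasing le_log_iff)
    have L1: "L \<ge> 1"
    proof -
      have "2 \<le> 1 / \<epsilon>" using \<epsilon> by (simp add: field_simps)
      then show ?thesis unfolding L_def using \<epsilon> by (simp add: le_log_iff)
    qed
    have D1: "real k ^ 2 * 16 ^ k * S ^ 2 * L ^ 2 \<ge> 1"
    proof -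
      have "1 * 1 * 1 * 1 \<le> real k ^ 2 * 16 ^ k * S ^ 2 * L ^ 2"
        using k S1 L1 by (intro mult_mono) auto
      then show ?thesis by simp
    qed
    show ?thesis
    \<comment> \<open>The union bound over the leaves uses \<open>s <= n^2\<close>. Otherwise the
      claim is immediate, since the denominator is at least 1.\<close>
    proof (cases "s < n ^ 2")
      case True
      define T where "T = nat \<lceil>400 * sqrt s\<rceil>"
      define l where "l = nat \<lceil>L\<rceil> + 2"
      have "(1/2 :: real) ^ l \<le> \<epsilon> / 4"
      proof -
        have "4 / \<epsilon> = 2 powr (L + 2)" using \<epsilon> by (simp add: L_def powr_add)
        also have "\<dots> \<le> 2 powr real l" unfolding l_def by (intro powr_mono) linarith+
        also have "\<dots> = 2 ^ l" by (simp add: powr_realpow)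
        finally show ?thesis using \<epsilon> by (simp add: field_simps)
      qed
      moreover have "real T \<ge> 400 * sqrt s" unfolding T_def by linarith
      moreover have "real s \<le> real n ^ 2" using True by (metis less_imp_le of_nat_le_iff of_nat_power)
      ultimately have "\<epsilon> / 2 \<le> (1 + 2 * (1 + 2 * real (2 * s + 1) ^ T) ^ (2 * l)) *
          2 ^ (2 * l * T * R) * (1 - (1/4) ^ (k - 1)) ^ m"
        unfolding R_def using k m n s \<epsilon> C adv by (intro correlation_upper_bound) auto
      then have "real m / 4 ^ k \<le> 8020 * (L * sqrt s * S)"
        unfolding S_def using k m n s True \<epsilon> L_def T_def l_def by (intro size_from_correlation)
      \<comment> \<open>Squaring turns \<open>4 ^ k\<close> into \<open>16 ^ k\<close>,
        \<open>sqrt s\<close> into \<open>s\<close> and 8020 into the constant of the theorem;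
        multiplying by \<open>k^2\<close> restores \<open>n = k * m\<close>.\<close>
      then have "(real m / 4 ^ k)\<^sup>2 \<le> (8020 * (L * sqrt s * S))\<^sup>2"
        by (intro power_mono) auto
      also have "\<dots> = 8020\<^sup>2 * (L\<^sup>2 * S\<^sup>2) * s" by (simp add: power_mult_distrib)
      finally have 1: "(real m / 4 ^ k)\<^sup>2 \<le> 8020\<^sup>2 * (L\<^sup>2 * S\<^sup>2) * s" .
      have "(4 ^ k)\<^sup>2 = (16 ^ k :: real)" by (simp add: power2_eq_square flip: power_mult_distrib)
      then have "(real m)\<^sup>2 \<le> 8020\<^sup>2 * (L\<^sup>2 * S\<^sup>2) * s * 16 ^ k"
        using 1 by (simp add: field_simps)
      then have "real k ^ 2 * (real m)\<^sup>2 \<le> real k ^ 2 * (8020\<^sup>2 * (L\<^sup>2 * S\<^sup>2) * s * 16 ^ k)"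
        by (intro mult_left_mono) auto
      then have "real n ^ 2 \<le> 8020\<^sup>2 * s * (real k ^ 2 * 16 ^ k * S ^ 2 * L ^ 2)"
        by (simp add: n power_mult_distrib mult_ac)
      then show ?thesis using D1 by (simp add: divide_le_eq mult_ac)
    next
      case False
      have "1 / 8020\<^sup>2 * real n ^ 2 / (real k ^ 2 * 16 ^ k * S ^ 2 * L ^ 2) \<le> 1 / 8020\<^sup>2 * real n ^ 2 / 1"
        using D1 by (intro divide_left_mono) auto
      also have "\<dots> \<le> real n ^ 2" by simp
      also have "\<dots> \<le> real s" using False by (metis not_less of_nat_le_iff of_nat_power)
      finally show ?thesis .
    qed
  qed
  then show "real s \<ge> 1 / 8020\<^sup>2 * real n ^ 2 /
         (real k ^ 2 * 16 ^ k *
          (real (R_nof_class k n (\<epsilon> / (2 * real n ^ 2)) G) + log 2 (real n)) ^ 2 *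
          (log 2 (1 / \<epsilon>)) ^ 2)"
    unfolding S_def L_def R_def .
qed simp

end
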